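(* Let $G$ be a simple graph on $l$ vertices, let $\mathfrak{g}$ be the Kac-Moody algebra with Dynkin diagram $G$, and let $L_G$ be the bond lattice of $G$ with minimal element $\hat 0$. Then for every $\pi\in L_G$, $$\operatorname{mult}\pi=\sum_{p} w(p),$$ where the sum is over all directed paths $p$ in $L_G$ with $\operatorname{start}(p)=\pi$ and $\operatorname{end}(p)=\hat 0$, and $w(p)$ is the weight of $p$.
   Context: $G$ is a simple graph on $l$ vertices, not assumed connected. Let $A$ be its adjacency matrix and $B:=2I-A$, a symmetric generalized Cartan matrix. $\mathfrak{g}$ is the complex Kac-Moody Lie algebra constructed from $B$ (generated by a Cartan subalgebra $\mathfrak{h}$ from a minimal realization of $B$ and Chevalley generators $e_i,f_i$ subject to the Chevalley-Serre relations). Its root space decomposition is $\mathfrak{g}=\mathfrak{h}\oplus\bigoplus_{\alpha\in\Delta_+}(\mathfrak{g}_\alpha\oplus\mathfrak{g}_{-\alpha})$ with $\Delta_+$ the set of positive roots; $\operatorname{mult}\alpha:=\dim\mathfrak{g}_\alpha$. The set $\Pi$ of simple roots is identified with the vertex set of $G$. For $S\subset\Pi$, $\beta(S):=\sum_{\alpha\in S}\alpha$. A non-empty $S\subset\Pi$ is called connected if the subgraph of $G$ induced by $S$ is connected (equivalently $\operatorname{mult}\beta(S)>0$). The bond lattice $L_G$ is the set of all partitions $\pi=\{S_1,\dots,S_k\}$ of $\Pi$ into non-empty pairwise disjoint connected subsets, partially ordered by refinement: $\pi\ge\pi'$ iff $\pi'$ refines $\pi$. Here $|\pi|:=k$, and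 $\hat 0$ is the partition into $l$ singletons. For $\pi=\{S_1,\dots,S_k\}\in L_G$, $\operatorname{mult}\pi:=\prod_{i=1}^k\operatorname{mult}\beta(S_i)$, and $d(\pi):=\#\{1\le i\le k:|S_i|>1\}$ is the number of non-singleton parts. For $S\subset\Pi$, $\boldsymbol{e}(S)$ is the number of edges of $G$ with both ends in $S$; for disjoint $S,S'$, $\boldsymbol{e}(S,S')$ is the number of edges of $G$ with one end in $S$ and the other in $S'$. $L_G$ is viewed as a directed graph with an edge $\pi\rightarrow\pi'$ whenever $\pi$ covers $\pi'$ in $L_G$. In that case one can write $\pi=\{S_1,\dots,S_k\}$, $\pi'=\{S'_1,\dots,S'_{k+1}\}$ with $S_i=S'_i$ for $1\le i<k$ and $S_k=S'_k\sqcup S'_{k+1}$, and the weight of the edge is $$w(\pi,\pi'):=\frac{1}{d(\pi)}\,\frac{\boldsymbol{e}(S'_k,S'_{k+1})}{\boldsymbol{e}(S_k)}.$$ For a directed path $p:\pi_1\rightarrow\pi_2\rightarrow\cdots\rightarrow\pi_r$ ($r\ge1$), $\operatorname{start}(p):=\pi_1$, $\operatorname{end}(p):=\pi_r$, and $w(p):=\prod_{i=1}^{r-1}w(\pi_i,\pi_{i+1})$, with $w(p):=1$ if $r=1$. *)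

theory Defs
  imports
    "HOL-Analysis.Cartesian_Space"
    "HOL-Library.Disjoint_Sets"
    "Jordan_Normal_Form.Missing_VectorSpace"
begin

section \<open>Complex Lie algebras given by generators and relations\<close>

definition complex_field :: "complex ring" where
  "complex_field = \<lparr>carrier = UNIV, mult = (*), one = 1, zero = 0, add = (+)\<rparr>"

text \<open>The fields \<^const>\<open>mult\<close> and \<^const>\<open>one\<close>, which a module record inherits from rings, carry no
  meaning here; the Lie bracket is a separate field.\<close>

record 'a lie_ring = "(complex, 'a) module" +
  bracket :: "'a \<Rightarrow> 'a \<Rightarrow> 'a"

locale complex_lie_algebra = vectorspace complex_field L
  for L :: "'a lie_ring" (structure) +
  assumes bracket_closed:
      "\<lbrakk>x \<in> carrier L; y \<in> carrier L\<rbrakk> \<Longrightarrow> bracket L x y \<in> carrier L"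
    and bracket_add_left:
      "\<lbrakk>x \<in> carrier L; y \<in> carrier L; z \<in> carrier L\<rbrakk> \<Longrightarrow>
        bracket L (x \<oplus> y) z = bracket L x z \<oplus> bracket L y z"
    and bracket_add_right:
      "\<lbrakk>x \<in> carrier L; y \<in> carrier L; z \<in> carrier L\<rbrakk> \<Longrightarrow>
        bracket L x (y \<oplus> z) = bracket L x y \<oplus> bracket L x z"
    and bracket_smult_left:
      "\<lbrakk>x \<in> carrier L; y \<in> carrier L\<rbrakk> \<Longrightarrow>
        bracket L (c \<odot>\<^bsub>L\<^esub> x) y = c \<odot>\<^bsub>L\<^esub> bracket L x y"
    and bracket_smult_right:
      "\<lbrakk>x \<in> carrier L; y \<in> carrier L\<rbrakk> \<Longrightarrow>
        bracket L x (c \<odot>\<^bsub>L\<^esub> y) = c \<odot>\<^bsub>L\<^esub> bracket L x y"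
    and bracket_self: "x \<in> carrier L \<Longrightarrow> bracket L x x = \<zero>"
    and jacobi:
      "\<lbrakk>x \<in> carrier L; y \<in> carrier L; z \<in> carrier L\<rbrakk> \<Longrightarrow>
        bracket L x (bracket L y z) \<oplus> (bracket L y (bracket L z x) \<oplus> bracket L z (bracket L x y))
          = \<zero>"

datatype 'g lie_term =
    LZero
  | LGen 'g
  | LAdd "'g lie_term" "'g lie_term"
  | LScale complex "'g lie_term"
  | LBr "'g lie_term" "'g lie_term"

text \<open>The least congruence on terms that contains the defining relations \<open>R\<close> and whose quotient
  satisfies the axioms of a complex Lie algebra.\<close>

inductive lie_cong ::
    "('g lie_term \<Rightarrow> 'g lie_term \<Rightarrow> bool) \<Rightarrow> 'g lie_term \<Rightarrow> 'g lie_term \<Rightarrow> bool"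
  for R where
  base: "R s t \<Longrightarrow> lie_cong R s t"
| refl: "lie_cong R t t"
| sym: "lie_cong R s t \<Longrightarrow> lie_cong R t s"
| trans: "lie_cong R s t \<Longrightarrow> lie_cong R t u \<Longrightarrow> lie_cong R s u"
| cong_add: "lie_cong R s s' \<Longrightarrow> lie_cong R t t' \<Longrightarrow> lie_cong R (LAdd s t) (LAdd s' t')"
| cong_scale: "lie_cong R t t' \<Longrightarrow> lie_cong R (LScale c t) (LScale c t')"
| cong_br: "lie_cong R s s' \<Longrightarrow> lie_cong R t t' \<Longrightarrow> lie_cong R (LBr s t) (LBr s' t')"
| add_assoc: "lie_cong R (LAdd (LAdd s t) u) (LAdd s (LAdd t u))"
| add_commute: "lie_cong R (LAdd s t) (LAdd t s)"
| add_zero: "lie_cong R (LAdd LZero t) t"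
| add_inverse: "lie_cong R (LAdd (LScale (- 1) t) t) LZero"
| scale_add_left: "lie_cong R (LScale (a + b) t) (LAdd (LScale a t) (LScale b t))"
| scale_add_right: "lie_cong R (LScale a (LAdd s t)) (LAdd (LScale a s) (LScale a t))"
| scale_scale: "lie_cong R (LScale (a * b) t) (LScale a (LScale b t))"
| scale_one: "lie_cong R (LScale 1 t) t"
| br_add_left: "lie_cong R (LBr (LAdd s t) u) (LAdd (LBr s u) (LBr t u))"
| br_add_right: "lie_cong R (LBr u (LAdd s t)) (LAdd (LBr u s) (LBr u t))"
| br_scale_left: "lie_cong R (LBr (LScale c s) t) (LScale c (LBr s t))"
| br_scale_right: "lie_cong R (LBr s (LScale c t)) (LScale c (LBr s t))"
| br_self: "lie_cong R (LBr t t) LZero"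
| br_jacobi:
    "lie_cong R (LAdd (LBr s (LBr t u)) (LAdd (LBr t (LBr u s)) (LBr u (LBr s t)))) LZero"

definition lie_class ::
    "('g lie_term \<Rightarrow> 'g lie_term \<Rightarrow> bool) \<Rightarrow> 'g lie_term \<Rightarrow> 'g lie_term set" where
  "lie_class R t = {u. lie_cong R t u}"

definition presented_lie_algebra ::
    "('g lie_term \<Rightarrow> 'g lie_term \<Rightarrow> bool) \<Rightarrow> 'g lie_term set lie_ring" where
  "presented_lie_algebra R =
    \<lparr>carrier = range (lie_class R),
     mult = undefined,
     one = undefined,
     zero = lie_class R LZero,
     add = (\<lambda>X Y. \<Union>s\<in>X. \<Union>t\<in>Y. lie_class R (LAdd s t)),
     smult = (\<lambda>c X. \<Union>t\<in>X. lie_class R (LScale c t)),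
     bracket = (\<lambda>X Y. \<Union>s\<in>X. \<Union>t\<in>Y. lie_class R (LBr s t))\<rparr>"

lemma lie_class_eq_iff: "lie_class R s = lie_class R t \<longleftrightarrow> lie_cong R s t"
  unfolding lie_class_def by (auto intro: lie_cong.intros)

lemma presented_lie_algebra_simps:
  "carrier (presented_lie_algebra R) = range (lie_class R)"
  "\<zero>\<^bsub>presented_lie_algebra R\<^esub> = lie_class R LZero"
  "lie_class R s \<oplus>\<^bsub>presented_lie_algebra R\<^esub> lie_class R t = lie_class R (LAdd s t)"
  "c \<odot>\<^bsub>presented_lie_algebra R\<^esub> lie_class R t = lie_class R (LScale c t)"
  "bracket (presented_lie_algebra R) (lie_class R s) (lie_class R t) = lie_class R (LBr s t)"
  unfolding presented_lie_algebra_def lie_class_def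
  by (auto intro: lie_cong.intros)

lemma complex_field_simps:
  "carrier complex_field = UNIV" "x \<otimes>\<^bsub>complex_field\<^esub> y = x * y" "\<one>\<^bsub>complex_field\<^esub> = 1"
  "\<zero>\<^bsub>complex_field\<^esub> = 0" "x \<oplus>\<^bsub>complex_field\<^esub> y = x + y"
  by (simp_all add: complex_field_def)

lemma field_complex_field: "field complex_field"
proof -
  have "cring complex_field"
    by (intro cringI abelian_groupI comm_monoidI)
      (auto simp: complex_field_simps algebra_simps intro: exI[of _ "- x" for x])
  then show ?thesis
    by (rule cring.cring_fieldI2)
      (auto simp: complex_field_simps intro: right_inverse)
qed

lemma complex_lie_algebra_presented: "complex_lie_algebra (presented_lie_algebra R)"
proof -
  interpret field complex_field by (rule field_complex_field)
  have grp: "abelian_group (presented_lie_algebra R)"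
  proof (rule abelian_groupI)
    fix x assume "x \<in> carrier (presented_lie_algebra R)"
    then obtain t where "x = lie_class R t" by (auto simp: presented_lie_algebra_simps)
    then show "\<exists>y\<in>carrier (presented_lie_algebra R).
        y \<oplus>\<^bsub>presented_lie_algebra R\<^esub> x = \<zero>\<^bsub>presented_lie_algebra R\<^esub>"
      by (intro bexI[of _ "lie_class R (LScale (- 1) t)"])
        (auto simp: presented_lie_algebra_simps lie_class_eq_iff intro: lie_cong.add_inverse)
  qed (auto simp: presented_lie_algebra_simps lie_class_eq_iff
      del: equalityI intro!: rangeI
      intro: lie_cong.add_assoc lie_cong.add_commute lie_cong.add_zero)
  have "Module.module complex_field (presented_lie_algebra R)"
    by (intro moduleI is_cring grp)
      (auto simp: presented_lie_algebra_simps lie_class_eq_iff complex_field_simps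
        del: equalityI intro!: rangeI
        intro: lie_cong.scale_add_left lie_cong.scale_add_right lie_cong.scale_scale
          lie_cong.scale_one)
  then have "vectorspace complex_field (presented_lie_algebra R)"
    by (intro vectorspace.intro field_complex_field)
  then show ?thesis
    by (intro complex_lie_algebra.intro complex_lie_algebra_axioms.intro)
      (auto simp: presented_lie_algebra_simps lie_class_eq_iff
        del: equalityI intro!: rangeI
        intro: lie_cong.br_add_left lie_cong.br_add_right lie_cong.br_scale_left
          lie_cong.br_scale_right lie_cong.br_self lie_cong.br_jacobi)
qed


section \<open>Kac--Moody algebras\<close>

text \<open>A minimal realization of an \<open>n \<times> n\<close> matrix \<open>B\<close>: a complex vector space of dimension
  \<open>2 n - rank B\<close> (here the whole type \<^typ>\<open>'h\<close>, with scalar multiplication \<open>hscale\<close>) with linearly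
  independent coroots in it and linearly independent simple roots \<open>\<alpha> j\<close> in its dual, such that
  \<open>\<alpha> j (coroot i) = B $ i $ j\<close>.\<close>

locale minimal_realization = vector_space hscale
  for hscale :: "complex \<Rightarrow> 'h::ab_group_add \<Rightarrow> 'h" +
  fixes B :: "int ^ 'v::finite ^ 'v"
    and \<alpha> :: "'v \<Rightarrow> 'h \<Rightarrow> complex"
    and coroot :: "'v \<Rightarrow> 'h"
  assumes finite_dimensional: "\<exists>A. finite A \<and> span A = UNIV"
    and dimension:
      "dim (UNIV :: 'h set) = 2 * CARD('v) - rank (\<chi> i j. complex_of_int (B $ i $ j))"
    and root_linear: "Vector_Spaces.linear hscale (*) (\<alpha> i)"
    and coroots_independent: "(\<Sum>i\<in>UNIV. hscale (c i) (coroot i)) = 0 \<Longrightarrow> c i = 0"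
    and roots_independent: "(\<And>x. (\<Sum>i\<in>UNIV. c i * \<alpha> i x) = 0) \<Longrightarrow> c i = 0"
    and pairing: "\<alpha> j (coroot i) = of_int (B $ i $ j)"

datatype ('h, 'v) km_gen = GenH 'h | GenE 'v | GenF 'v

abbreviation "LH x \<equiv> LGen (GenH x)"
abbreviation "LE i \<equiv> LGen (GenE i)"
abbreviation "LF i \<equiv> LGen (GenF i)"

text \<open>The first two relations make the span of the generators \<open>LH x\<close> a linear image of the Cartan
  subalgebra.\<close>

inductive km_rel ::
    "(complex \<Rightarrow> 'h::ab_group_add \<Rightarrow> 'h) \<Rightarrow> int ^ 'v::finite ^ 'v \<Rightarrow> ('v \<Rightarrow> 'h \<Rightarrow> complex) \<Rightarrow>
      ('v \<Rightarrow> 'h) \<Rightarrow> ('h, 'v) km_gen lie_term \<Rightarrow> ('h, 'v) km_gen lie_term \<Rightarrow> bool"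
  for hscale B \<alpha> coroot where
  h_add: "km_rel hscale B \<alpha> coroot (LH (x + y)) (LAdd (LH x) (LH y))"
| h_scale: "km_rel hscale B \<alpha> coroot (LH (hscale c x)) (LScale c (LH x))"
| hh: "km_rel hscale B \<alpha> coroot (LBr (LH x) (LH y)) LZero"
| ef_same: "km_rel hscale B \<alpha> coroot (LBr (LE i) (LF i)) (LH (coroot i))"
| ef_diff: "i \<noteq> j \<Longrightarrow> km_rel hscale B \<alpha> coroot (LBr (LE i) (LF j)) LZero"
| he: "km_rel hscale B \<alpha> coroot (LBr (LH x) (LE i)) (LScale (\<alpha> i x) (LE i))"
| hf: "km_rel hscale B \<alpha> coroot (LBr (LH x) (LF i)) (LScale (- \<alpha> i x) (LF i))"
| serre_e: "i \<noteq> j \<Longrightarrow> km_rel hscale B \<alpha> coroot ((LBr (LE i) ^^ nat (1 - B $ i $ j)) (LE j)) LZero"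
| serre_f: "i \<noteq> j \<Longrightarrow> km_rel hscale B \<alpha> coroot ((LBr (LF i) ^^ nat (1 - B $ i $ j)) (LF j)) LZero"

definition kac_moody ::
    "(complex \<Rightarrow> 'h::ab_group_add \<Rightarrow> 'h) \<Rightarrow> int ^ 'v::finite ^ 'v \<Rightarrow> ('v \<Rightarrow> 'h \<Rightarrow> complex) \<Rightarrow>
      ('v \<Rightarrow> 'h) \<Rightarrow> ('h, 'v) km_gen lie_term set lie_ring" where
  "kac_moody hscale B \<alpha> coroot = presented_lie_algebra (km_rel hscale B \<alpha> coroot)"

definition root_space ::
    "(complex \<Rightarrow> 'h::ab_group_add \<Rightarrow> 'h) \<Rightarrow> int ^ 'v::finite ^ 'v \<Rightarrow> ('v \<Rightarrow> 'h \<Rightarrow> complex) \<Rightarrow>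
      ('v \<Rightarrow> 'h) \<Rightarrow> ('h \<Rightarrow> complex) \<Rightarrow> ('h, 'v) km_gen lie_term set set" where
  "root_space hscale B \<alpha> coroot \<gamma> =
    {X \<in> carrier (kac_moody hscale B \<alpha> coroot).
      \<forall>x. bracket (kac_moody hscale B \<alpha> coroot) (lie_class (km_rel hscale B \<alpha> coroot) (LH x)) X
            = \<gamma> x \<odot>\<^bsub>kac_moody hscale B \<alpha> coroot\<^esub> X}"

definition root_mult ::
    "(complex \<Rightarrow> 'h::ab_group_add \<Rightarrow> 'h) \<Rightarrow> int ^ 'v::finite ^ 'v \<Rightarrow> ('v \<Rightarrow> 'h \<Rightarrow> complex) \<Rightarrow>
      ('v \<Rightarrow> 'h) \<Rightarrow> ('h \<Rightarrow> complex) \<Rightarrow> nat" where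
  "root_mult hscale B \<alpha> coroot \<gamma> =
    vectorspace.dim complex_field
      ((kac_moody hscale B \<alpha> coroot)\<lparr>carrier := root_space hscale B \<alpha> coroot \<gamma>\<rparr>)"

definition root_sum :: "('v \<Rightarrow> 'h \<Rightarrow> complex) \<Rightarrow> 'v set \<Rightarrow> 'h \<Rightarrow> complex" where
  "root_sum \<alpha> S = (\<lambda>x. \<Sum>i\<in>S. \<alpha> i x)"


section \<open>Simple graphs and the bond lattice\<close>

text \<open>The vertex set is the whole finite type; a graph is given by its set of edges, which are
  two-element sets of vertices.\<close>

definition simple_graph :: "'v::finite set set \<Rightarrow> bool" where
  "simple_graph E \<longleftrightarrow> (\<forall>e\<in>E. card e = 2)"

definition adjacency_matrix :: "'v::finite set set \<Rightarrow> int ^ 'v ^ 'v" where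
  "adjacency_matrix E = (\<chi> i j. if {i, j} \<in> E then 1 else 0)"

definition cartan_matrix :: "'v::finite set set \<Rightarrow> int ^ 'v ^ 'v" where
  "cartan_matrix E = mat 2 - adjacency_matrix E"

definition connected_in :: "'v set set \<Rightarrow> 'v set \<Rightarrow> bool" where
  "connected_in E S \<longleftrightarrow>
    S \<noteq> {} \<and> (\<forall>u\<in>S. \<forall>v\<in>S. (u, v) \<in> {(a, b). a \<in> S \<and> b \<in> S \<and> {a, b} \<in> E}\<^sup>*)"

definition edges_in :: "'v set set \<Rightarrow> 'v set \<Rightarrow> nat" where
  "edges_in E S = card {e \<in> E. e \<subseteq> S}"

definition edges_between :: "'v set set \<Rightarrow> 'v set \<Rightarrow> 'v set \<Rightarrow> nat" where
  "edges_between E S T = card {e \<in> E. \<exists>u\<in>S. \<exists>v\<in>T. e = {u, v}}"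

definition bond_lattice :: "'v set set \<Rightarrow> 'v set set set" where
  "bond_lattice E = {\<pi>. partition_on UNIV \<pi> \<and> (\<forall>S\<in>\<pi>. connected_in E S)}"

definition singletons :: "'v set set" where
  "singletons = range (\<lambda>v. {v})"

definition bond_covers :: "'v set set \<Rightarrow> 'v set set \<Rightarrow> 'v set set \<Rightarrow> bool" where
  "bond_covers E \<pi> \<pi>' \<longleftrightarrow>
    \<pi> \<in> bond_lattice E \<and> \<pi>' \<in> bond_lattice E \<and> refines UNIV \<pi>' \<pi> \<and> \<pi>' \<noteq> \<pi> \<and>
    \<not> (\<exists>\<rho>\<in>bond_lattice E. refines UNIV \<pi>' \<rho> \<and> refines UNIV \<rho> \<pi> \<and> \<rho> \<noteq> \<pi>' \<and> \<rho> \<noteq> \<pi>)"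

definition nonsingleton_parts :: "'v set set \<Rightarrow> nat" where
  "nonsingleton_parts \<pi> = card {S \<in> \<pi>. card S > 1}"

text \<open>If \<open>\<pi>\<close> covers \<open>\<pi>'\<close>, then \<open>\<pi>'\<close> arises from \<open>\<pi>\<close> by splitting one part \<open>S\<close> into two parts
  \<open>T\<close>, \<open>T'\<close>, so the description below determines a unique number.\<close>

definition edge_weight :: "'v set set \<Rightarrow> 'v set set \<Rightarrow> 'v set set \<Rightarrow> real" where
  "edge_weight E \<pi> \<pi>' =
    (THE w. \<exists>S T T'. S \<in> \<pi> \<and> T \<in> \<pi>' \<and> T' \<in> \<pi>' \<and> T \<inter> T' = {} \<and> S = T \<union> T' \<and>
      \<pi> - {S} = \<pi>' - {T, T'} \<and>
      w = 1 / real (nonsingleton_parts \<pi>) * (real (edges_between E T T') / real (edges_in E S)))"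

definition bond_paths :: "'v set set \<Rightarrow> 'v set set \<Rightarrow> 'v set set \<Rightarrow> 'v set set list set" where
  "bond_paths E \<pi> \<pi>' =
    {p. p \<noteq> [] \<and> set p \<subseteq> bond_lattice E \<and> successively (bond_covers E) p \<and>
      hd p = \<pi> \<and> last p = \<pi>'}"

definition path_weight :: "'v set set \<Rightarrow> 'v set set list \<Rightarrow> real" where
  "path_weight E p = (\<Prod>i<length p - 1. edge_weight E (p ! i) (p ! Suc i))"

definition partition_mult ::
    "(complex \<Rightarrow> 'h::ab_group_add \<Rightarrow> 'h) \<Rightarrow> 'v::finite set set \<Rightarrow> ('v \<Rightarrow> 'h \<Rightarrow> complex) \<Rightarrow>
      ('v \<Rightarrow> 'h) \<Rightarrow> 'v set set \<Rightarrow> nat" where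
  "partition_mult hscale E \<alpha> coroot \<pi> =
    (\<Prod>S\<in>\<pi>. root_mult hscale (cartan_matrix E) \<alpha> coroot (root_sum \<alpha> S))"

end

theory Submission
  imports Defs
begin

text \<open>Let \<open>c(S)\<close> be the number of acyclic orientations of the induced subgraph on \<open>S\<close> whose only sink
  is a fixed vertex \<open>a \<in> S\<close>. The root space of \<open>\<beta>(S)\<close> is spanned by the brackets
  \<open>[e\<^sub>1, [e\<^sub>2, \<dots>, [e\<^sub>k, e\<^sub>a]]]\<close> over enumerations of \<open>S\<close> ending in \<open>a\<close>. As \<open>e\<^sub>i\<close> and \<open>e\<^sub>j\<close>
  commute for non-adjacent \<open>i\<close>, \<open>j\<close>, such a bracket depends only on the orientation induced by the
  enumeration and vanishes if there is another sink. The brackets of different orientations are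
  independent because they are separated by the dual of the Verma module of lowest weight \<open>0\<close>,
  realised on functions of words. Hence \<open>mult \<beta>(S) = c(S)\<close>; in particular \<open>c(S)\<close> does not depend
  on \<open>a\<close>.

  Cutting an orientation with sink \<open>a\<close> along the set of vertices that reach \<open>b\<close>, for an edge
  \<open>{a, b}\<close>, gives \<open>c(S) = \<Sum> c(T) c(S - T)\<close> over all \<open>T\<close> with \<open>a \<in> T\<close> and \<open>b \<notin> T\<close>. Summation over
  all edges turns this into \<open>e(S) c(S) = \<Sum> e(T, T') c(T) c(T')\<close> over unordered splittings of \<open>S\<close>.
  Averaged over the non-singleton parts of \<open>\<pi>\<close>, this is the recursion
  \<open>mult \<pi> = \<Sum> w(\<pi>, \<pi>') mult \<pi>'\<close> over the elements covered by \<open>\<pi>\<close>, which the path sum satisfies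
  too.\<close>

section \<open>Terms modulo the Lie algebra axioms\<close>

declare lie_cong.trans [trans]

context
  fixes R :: "'g lie_term \<Rightarrow> 'g lie_term \<Rightarrow> bool"
begin

abbreviation cong_mod (infix "\<approx>" 50) where "s \<approx> t \<equiv> lie_cong R s t"

text \<open>Cancellation is borrowed from the quotient, which is a vector space, instead of being
  derived from the rules of \<open>lie_cong\<close>.\<close>

lemma eq_neg_of_add_eq_zero:
  assumes "LAdd s t \<approx> LZero"
  shows "s \<approx> LScale (- 1) t"
proof -
  interpret L: complex_lie_algebra "presented_lie_algebra R"
    by (rule complex_lie_algebra_presented)
  have "lie_class R s \<oplus>\<^bsub>presented_lie_algebra R\<^esub> lie_class R t =
      lie_class R (LScale (- 1) t) \<oplus>\<^bsub>presented_lie_algebra R\<^esub> lie_class R t"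
    using assms lie_cong.add_inverse[of R t]
    by (simp add: presented_lie_algebra_simps lie_class_eq_iff)
      (metis lie_cong.trans lie_cong.sym)
  then show ?thesis
    by (subst (asm) L.add.right_cancel)
      (auto simp: presented_lie_algebra_simps lie_class_eq_iff)
qed

lemma add_zero_right: "LAdd t LZero \<approx> t"
  using lie_cong.add_commute lie_cong.add_zero lie_cong.trans by blast

lemma scale_zero_left: "LScale 0 t \<approx> LZero"
proof -
  interpret L: complex_lie_algebra "presented_lie_algebra R"
    by (rule complex_lie_algebra_presented)
  show ?thesis
    using L.smult_l_null[of "lie_class R t"]
    by (simp add: presented_lie_algebra_simps lie_class_eq_iff complex_field_simps rangeI)
qed

lemma scale_zero_right: "LScale c LZero \<approx> LZero"
proof -
  interpret L: complex_lie_algebra "presented_lie_algebra R"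
    by (rule complex_lie_algebra_presented)
  show ?thesis
    using L.smult_r_null[of c]
    by (simp add: presented_lie_algebra_simps lie_class_eq_iff complex_field_simps rangeI)
qed

lemma br_zero_right: "LBr t LZero \<approx> LZero"
  by (meson lie_cong.br_scale_right lie_cong.cong_br lie_cong.refl lie_cong.sym lie_cong.trans
      scale_zero_left)

text \<open>Polarisation: expand \<open>[s + t, s + t] = 0\<close>, where \<open>[s, s]\<close> and
  \<open>[t, t]\<close> vanish as well.\<close>

lemma br_anticommute: "LBr s t \<approx> LScale (- 1) (LBr t s)"
proof -
  interpret L: complex_lie_algebra "presented_lie_algebra R"
    by (rule complex_lie_algebra_presented)
  let ?c = "lie_class R"
  have "bracket (presented_lie_algebra R) (?c (LAdd s t)) (?c (LAdd s t)) =
     (?c (LBr s s) \<oplus>\<^bsub>presented_lie_algebra R\<^esub> ?c (LBr s t)) \<oplus>\<^bsub>presented_lie_algebra R\<^esub>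
     (?c (LBr t s) \<oplus>\<^bsub>presented_lie_algebra R\<^esub> ?c (LBr t t))"
    by (simp add: presented_lie_algebra_simps lie_class_eq_iff)
      (meson lie_cong.br_add_left lie_cong.br_add_right lie_cong.cong_add lie_cong.trans)
  moreover have "?c (LBr u u) = \<zero>\<^bsub>presented_lie_algebra R\<^esub>" for u
    by (simp add: presented_lie_algebra_simps lie_class_eq_iff lie_cong.br_self)
  ultimately have "?c (LBr s t) \<oplus>\<^bsub>presented_lie_algebra R\<^esub> ?c (LBr t s) = \<zero>\<^bsub>presented_lie_algebra R\<^esub>"
    using L.bracket_self[of "?c (LAdd s t)"] L.l_zero[of "?c (LBr s t)"] L.r_zero[of "?c (LBr t s)"]
    by (simp add: presented_lie_algebra_simps(1))
  then show ?thesis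
    by (intro eq_neg_of_add_eq_zero) (simp add: presented_lie_algebra_simps lie_class_eq_iff)
qed

lemma neg_neg: "LScale (- 1) (LScale (- 1) t) \<approx> t"
  using lie_cong.scale_scale[of R "-1" "-1" t] lie_cong.scale_one[of R t]
  by (metis lie_cong.sym lie_cong.trans minus_mult_minus mult_1)

text \<open>The Jacobi identity in the form \<open>ad [x, y] = ad x ad y - ad y ad x\<close>, which
  expands nested brackets.\<close>

lemma br_br_left:
  "LBr (LBr x y) z \<approx> LAdd (LBr x (LBr y z)) (LScale (- 1) (LBr y (LBr x z)))"
proof -
  have "LAdd (LBr z (LBr x y)) (LAdd (LBr x (LBr y z)) (LBr y (LBr z x))) \<approx> LZero"
    by (rule lie_cong.br_jacobi)
  then have 1: "LBr z (LBr x y) \<approx> LScale (- 1) (LAdd (LBr x (LBr y z)) (LBr y (LBr z x)))"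
    by (rule eq_neg_of_add_eq_zero)
  have "LBr (LBr x y) z \<approx> LScale (- 1) (LBr z (LBr x y))"
    by (rule br_anticommute)
  also have "\<dots> \<approx> LScale (- 1) (LScale (- 1) (LAdd (LBr x (LBr y z)) (LBr y (LBr z x))))"
    by (rule lie_cong.cong_scale[OF 1])
  also have "\<dots> \<approx> LAdd (LBr x (LBr y z)) (LBr y (LBr z x))"
    by (rule neg_neg)
  also have "\<dots> \<approx> LAdd (LBr x (LBr y z)) (LBr y (LScale (- 1) (LBr x z)))"
    by (intro lie_cong.cong_add lie_cong.cong_br lie_cong.refl br_anticommute)
  also have "\<dots> \<approx> LAdd (LBr x (LBr y z)) (LScale (- 1) (LBr y (LBr x z)))"
    by (intro lie_cong.cong_add lie_cong.refl lie_cong.br_scale_right)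
  finally show ?thesis .
qed

lemma br_commute_of_zero:
  assumes "LBr x y \<approx> LZero"
  shows "LBr x (LBr y z) \<approx> LBr y (LBr x z)"
proof -
  have "LZero \<approx> LBr (LScale 0 LZero) z"
    by (meson lie_cong.br_scale_left lie_cong.sym lie_cong.trans scale_zero_left)
  also have "\<dots> \<approx> LBr (LBr x y) z"
    by (meson assms lie_cong.cong_br lie_cong.refl lie_cong.sym lie_cong.trans scale_zero_left)
  also have "\<dots> \<approx> LAdd (LBr x (LBr y z)) (LScale (- 1) (LBr y (LBr x z)))"
    by (rule br_br_left)
  finally have "LBr x (LBr y z) \<approx> LScale (- 1) (LScale (- 1) (LBr y (LBr x z)))"
    by (rule eq_neg_of_add_eq_zero[OF lie_cong.sym])
  then show ?thesis using neg_neg lie_cong.trans by blast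
qed

text \<open>The rule \<open>cong\<close> closes the set under \<open>lie_cong\<close>, so this is
  the preimage of a linear span in the quotient, and linear algebra can be done on terms.\<close>

inductive_set lie_span for A where
  zero: "LZero \<in> lie_span A"
| base: "t \<in> A \<Longrightarrow> t \<in> lie_span A"
| add: "s \<in> lie_span A \<Longrightarrow> t \<in> lie_span A \<Longrightarrow> LAdd s t \<in> lie_span A"
| scale: "t \<in> lie_span A \<Longrightarrow> LScale c t \<in> lie_span A"
| cong: "t \<in> lie_span A \<Longrightarrow> s \<approx> t \<Longrightarrow> s \<in> lie_span A"

lemma lie_span_least: "A \<subseteq> lie_span B \<Longrightarrow> t \<in> lie_span A \<Longrightarrow> t \<in> lie_span B"
proof (rotate_tac, induction rule: lie_span.induct)
qed (auto intro: lie_span.intros)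

lemma lie_span_mono: "A \<subseteq> B \<Longrightarrow> lie_span A \<subseteq> lie_span B"
  using lie_span_least lie_span.base by (metis subset_iff)

lemma br_lie_span_right:
  assumes "\<And>t. t \<in> A \<Longrightarrow> LBr x t \<in> lie_span B" "t \<in> lie_span A"
  shows "LBr x t \<in> lie_span B"
  using assms(2)
proof (induction rule: lie_span.induct)
  case zero
  then show ?case using br_zero_right lie_span.cong lie_span.zero by blast
next
  case (base t)
  then show ?case using assms(1) by blast
next
  case (add s t)
  then show ?case by (meson lie_cong.br_add_right lie_span.add lie_span.cong)
next
  case (scale t c)
  then show ?case by (meson lie_cong.br_scale_right lie_span.scale lie_span.cong)
next
  case (cong t s)
  then show ?case by (meson lie_cong.cong_br lie_cong.refl lie_span.cong)
qed

lemma br_lie_span_commute: "LBr s t \<in> lie_span A \<Longrightarrow> LBr t s \<in> lie_span A"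
  by (meson br_anticommute lie_span.cong lie_span.scale)

lemma br_br_lie_span:
  assumes "LBr x (LBr y z) \<in> lie_span A" "LBr y (LBr x z) \<in> lie_span A"
  shows "LBr (LBr x y) z \<in> lie_span A"
  by (meson assms br_br_left lie_span.add lie_span.cong lie_span.scale)

text \<open>The terms that leave the span of a set stable form a Lie subalgebra, so all do as soon as
  the generators do.\<close>

lemma br_lie_span_stable:
  assumes gen: "\<And>g t. t \<in> A \<Longrightarrow> LBr (LGen g) t \<in> lie_span A"
  shows "t \<in> lie_span A \<Longrightarrow> LBr s t \<in> lie_span A"
proof (induction s arbitrary: t)
  case LZero
  have "LBr LZero t \<approx> LZero"
    by (meson br_anticommute br_zero_right lie_cong.cong_scale lie_cong.trans scale_zero_right)
  then show ?case using lie_span.cong lie_span.zero by blast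
next
  case (LGen g)
  then show ?case using br_lie_span_right gen by blast
next
  case (LAdd s s')
  then show ?case by (meson lie_cong.br_add_left lie_span.add lie_span.cong)
next
  case (LScale c s)
  then show ?case by (meson lie_cong.br_scale_left lie_span.scale lie_span.cong)
next
  case (LBr s s')
  then show ?case by (intro br_br_lie_span) blast+
qed

text \<open>By \<open>br_lie_span_stable\<close> the span is an ideal, and an ideal that contains
  all generators is everything.\<close>

lemma lie_span_UNIV:
  assumes gen: "\<And>g t. t \<in> A \<Longrightarrow> LBr (LGen g) t \<in> lie_span A"
    and "\<And>g. LGen g \<in> lie_span A"
  shows "t \<in> lie_span A"
proof (induction t)
  case (LBr s t)
  then show ?case using br_lie_span_stable[OF gen] by blast
qed (use assms(2) in \<open>auto intro: lie_span.intros\<close>)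

definition lie_sum :: "'g lie_term list \<Rightarrow> 'g lie_term" where
  "lie_sum ts = foldr LAdd ts LZero"

lemma lie_sum_simps [simp]: "lie_sum [] = LZero" "lie_sum (t # ts) = LAdd t (lie_sum ts)"
  by (simp_all add: lie_sum_def)

lemma lie_sum_append: "lie_sum (ss @ ts) \<approx> LAdd (lie_sum ss) (lie_sum ts)"
proof (induction ss)
  case Nil
  then show ?case by (simp add: lie_cong.add_zero lie_cong.sym)
next
  case (Cons s ss)
  then show ?case
    by simp (meson lie_cong.add_assoc lie_cong.cong_add lie_cong.refl lie_cong.sym lie_cong.trans)
qed

lemma lie_sum_scale: "LScale c (lie_sum ts) \<approx> lie_sum (map (LScale c) ts)"
proof (induction ts)
  case Nil
  then show ?case by (simp add: scale_zero_right)
next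
  case (Cons s ss)
  then show ?case
    by simp (meson lie_cong.scale_add_right lie_cong.cong_add lie_cong.refl lie_cong.trans)
qed

lemma add_cross: "LAdd (LAdd a b) (LAdd c d) \<approx> LAdd (LAdd a c) (LAdd b d)"
proof -
  interpret L: complex_lie_algebra "presented_lie_algebra R"
    by (rule complex_lie_algebra_presented)
  have car: "lie_class R t \<in> carrier (presented_lie_algebra R)" for t
    by (simp add: presented_lie_algebra_simps)
  show ?thesis
    unfolding lie_class_eq_iff[symmetric] presented_lie_algebra_simps(3)[symmetric]
    by (simp add: L.a_ac car)
qed

lemma scale_cancel:
  assumes "LScale c t \<approx> LZero" "c \<noteq> 0"
  shows "t \<approx> LZero"
proof -
  have "t \<approx> LScale (inverse c * c) t"
    using assms(2) by (simp add: lie_cong.scale_one lie_cong.sym)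
  also have "\<dots> \<approx> LScale (inverse c) (LScale c t)" by (rule lie_cong.scale_scale)
  also have "\<dots> \<approx> LScale (inverse c) LZero" by (rule lie_cong.cong_scale[OF assms(1)])
  also have "\<dots> \<approx> LZero" by (rule scale_zero_right)
  finally show ?thesis .
qed

section \<open>Weight vectors and the separation of weights\<close>

definition weight_vector :: "('x \<Rightarrow> 'g lie_term) \<Rightarrow> ('x \<Rightarrow> complex) \<Rightarrow> 'g lie_term \<Rightarrow> bool" where
  "weight_vector h \<mu> t \<longleftrightarrow> (\<forall>x. LBr (h x) t \<approx> LScale (\<mu> x) t)"

lemma weight_vector_cong: "weight_vector h \<mu> t \<Longrightarrow> s \<approx> t \<Longrightarrow> weight_vector h \<mu> s"
  unfolding weight_vector_def
  by (meson lie_cong.cong_br lie_cong.cong_scale lie_cong.refl lie_cong.sym lie_cong.trans)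

lemma weight_vector_zero: "weight_vector h \<mu> LZero"
  unfolding weight_vector_def
  by (meson br_zero_right lie_cong.sym lie_cong.trans scale_zero_right)

lemma weight_vector_add:
  "weight_vector h \<mu> s \<Longrightarrow> weight_vector h \<mu> t \<Longrightarrow> weight_vector h \<mu> (LAdd s t)"
  unfolding weight_vector_def
  by (meson lie_cong.br_add_right lie_cong.cong_add lie_cong.scale_add_right lie_cong.sym lie_cong.trans)

lemma scale_commute: "LScale c (LScale d t) \<approx> LScale d (LScale c t)"
  by (metis lie_cong.scale_scale lie_cong.sym lie_cong.trans mult.commute)

lemma weight_vector_scale:
  "weight_vector h \<mu> t \<Longrightarrow> weight_vector h \<mu> (LScale c t)"
  unfolding weight_vector_def
  by (meson lie_cong.br_scale_right lie_cong.cong_scale scale_commute lie_cong.trans)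

lemma weight_vector_lie_span:
  "t \<in> lie_span A \<Longrightarrow> (\<And>s. s \<in> A \<Longrightarrow> weight_vector h \<mu> s) \<Longrightarrow> weight_vector h \<mu> t"
  by (induction rule: lie_span.induct)
    (blast intro: weight_vector_zero weight_vector_add weight_vector_scale weight_vector_cong)+

text \<open>By the Jacobi identity \<open>ad (h x)\<close> is a derivation, so weights add up under
  brackets.\<close>

lemma weight_vector_br:
  assumes "weight_vector h \<mu> s" "weight_vector h \<nu> t"
  shows "weight_vector h (\<lambda>x. \<mu> x + \<nu> x) (LBr s t)"
  unfolding weight_vector_def
proof
  fix x
  have "LBr (LBr (h x) s) t \<approx> LAdd (LBr (h x) (LBr s t)) (LScale (- 1) (LBr s (LBr (h x) t)))"
    by (rule br_br_left)
  moreover have "LAdd (LBr (LBr (h x) s) t) (LBr s (LBr (h x) t)) \<approx>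
      LAdd (LScale (\<mu> x) (LBr s t)) (LScale (\<nu> x) (LBr s t))"
    using assms unfolding weight_vector_def
    by (meson lie_cong.br_scale_left lie_cong.br_scale_right lie_cong.cong_add lie_cong.cong_br
        lie_cong.refl lie_cong.trans)
  moreover have "LBr (h x) (LBr s t) \<approx> LAdd (LAdd (LBr (h x) (LBr s t))
      (LScale (- 1) (LBr s (LBr (h x) t)))) (LBr s (LBr (h x) t))"
    by (meson lie_cong.add_assoc lie_cong.add_commute lie_cong.add_inverse lie_cong.add_zero
        lie_cong.cong_add lie_cong.refl lie_cong.sym lie_cong.trans)
  ultimately show "LBr (h x) (LBr s t) \<approx> LScale (\<mu> x + \<nu> x) (LBr s t)"
    by (meson lie_cong.scale_add_left lie_cong.cong_add lie_cong.refl lie_cong.sym lie_cong.trans)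
qed

lemma weight_vector_defect:
  assumes "weight_vector h \<mu> t"
  shows "LAdd (LBr (h x) t) (LScale (- c) t) \<approx> LScale (\<mu> x - c) t"
  using assms lie_cong.scale_add_left[of R "\<mu> x" "- c" t]
  unfolding weight_vector_def
  by (simp; meson lie_cong.cong_add lie_cong.refl lie_cong.sym lie_cong.trans)

lemma lie_sum_defect:
  assumes "\<And>\<mu> t. (\<mu>, t) \<in> set ps \<Longrightarrow> weight_vector h \<mu> t"
  shows "LAdd (LBr (h x) (lie_sum (map snd ps))) (LScale (- c) (lie_sum (map snd ps))) \<approx>
    lie_sum (map (\<lambda>(\<mu>, t). LScale (\<mu> x - c) t) ps)"
  using assms
proof (induction ps)
  case Nil
  then show ?case
    by simp (meson br_zero_right scale_zero_right lie_cong.add_zero lie_cong.cong_add lie_cong.trans)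
next
  case (Cons p ps)
  obtain \<mu> t where p: "p = (\<mu>, t)" by force
  let ?s = "lie_sum (map snd ps)"
  have "LAdd (LBr (h x) (LAdd t ?s)) (LScale (- c) (LAdd t ?s)) \<approx>
      LAdd (LAdd (LBr (h x) t) (LBr (h x) ?s)) (LAdd (LScale (- c) t) (LScale (- c) ?s))"
    by (intro lie_cong.cong_add lie_cong.br_add_right lie_cong.scale_add_right)
  also have "\<dots> \<approx> LAdd (LAdd (LBr (h x) t) (LScale (- c) t)) (LAdd (LBr (h x) ?s) (LScale (- c) ?s))"
    by (rule add_cross)
  also have "\<dots> \<approx> LAdd (LScale (\<mu> x - c) t) (lie_sum (map (\<lambda>(\<mu>, t). LScale (\<mu> x - c) t) ps))"
    using Cons p by (intro lie_cong.cong_add weight_vector_defect) auto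
  finally show ?case using p by simp
qed

text \<open>Applying \<open>ad (h x) - \<mu> x\<close> removes a summand of weight \<open>\<mu>\<close> from the sum.\<close>

lemma weight_sum_zero:
  assumes "\<And>\<mu> t. (\<mu>, t) \<in> set ps \<Longrightarrow> \<mu> \<noteq> \<gamma> \<and> weight_vector h \<mu> t"
    and "weight_vector h \<gamma> (lie_sum (map snd ps))"
  shows "lie_sum (map snd ps) \<approx> LZero"
  using assms
proof (induction "length ps" arbitrary: ps)
  case 0
  then show ?case by (simp add: lie_cong.refl)
next
  case (Suc n)
  then obtain \<nu> s qs where ps: "ps = (\<nu>, s) # qs" and n: "n = length qs"
    by (cases ps) auto
  have w: "weight_vector h \<mu> t" "\<mu> \<noteq> \<gamma>" if "(\<mu>, t) \<in> set ps" for \<mu> t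
    using Suc.prems(1) that by blast+
  have "\<nu> \<noteq> \<gamma>" using w(2)[of \<nu> s] ps by simp
  then obtain x where x: "\<nu> x \<noteq> \<gamma> x" by blast
  let ?r = "lie_sum (map snd ps)"
  \<comment> \<open>The image of the tail under \<open>ad (h x) - \<nu> x\<close>. Coefficients may
    become 0, which is harmless because the zero term has every weight.\<close>
  define rs where "rs = map (\<lambda>(\<mu>, t). (\<mu>, LScale (\<mu> x - \<nu> x) t)) qs"
  have snd_rs: "map snd rs = map (\<lambda>(\<mu>, t). LScale (\<mu> x - \<nu> x) t) qs"
    by (simp add: rs_def case_prod_unfold)
  have "LScale (\<gamma> x - \<nu> x) ?r \<approx> LAdd (LBr (h x) ?r) (LScale (- \<nu> x) ?r)"
    by (rule lie_cong.sym[OF weight_vector_defect[OF Suc.prems(2)]])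
  also have "\<dots> \<approx> lie_sum (map (\<lambda>(\<mu>, t). LScale (\<mu> x - \<nu> x) t) ps)"
    by (rule lie_sum_defect) (rule w)
  also have "\<dots> \<approx> LAdd LZero (lie_sum (map snd rs))"
    by (simp add: ps snd_rs) (meson scale_zero_left lie_cong.cong_add lie_cong.refl)
  also have "\<dots> \<approx> lie_sum (map snd rs)" by (rule lie_cong.add_zero)
  finally have eq: "LScale (\<gamma> x - \<nu> x) ?r \<approx> lie_sum (map snd rs)" .
  have "weight_vector h \<gamma> (lie_sum (map snd rs))"
    using weight_vector_cong[OF weight_vector_scale[OF Suc.prems(2)] lie_cong.sym[OF eq]] .
  moreover have "\<mu> \<noteq> \<gamma> \<and> weight_vector h \<mu> t" if "(\<mu>, t) \<in> set rs" for \<mu> t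
    using that w ps by (auto simp: rs_def intro: weight_vector_scale)
  ultimately have "lie_sum (map snd rs) \<approx> LZero"
    using Suc.hyps(1)[of rs] n by (simp add: rs_def)
  from lie_cong.trans[OF eq this] show ?case
    by (rule scale_cancel) (use x in simp)
qed

text \<open>The summands of weight other than \<gamma> are kept as a list of labelled terms, with
  repeated weights allowed: this form survives sums and multiples and is what
  \<open>weight_sum_zero\<close> expects.\<close>

lemma lie_span_weight_decomposition:
  assumes "t \<in> lie_span A" "\<And>t. t \<in> A \<Longrightarrow> t \<in> B \<or> (\<exists>\<mu>. \<mu> \<noteq> \<gamma> \<and> weight_vector h \<mu> t)"
  shows "\<exists>s\<in>lie_span B. \<exists>ps. (\<forall>(\<mu>, t)\<in>set ps. \<mu> \<noteq> \<gamma> \<and> weight_vector h \<mu> t) \<and>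
    t \<approx> LAdd s (lie_sum (map snd ps))"
  using assms(1)
proof (induction rule: lie_span.induct)
  case zero
  then show ?case
    by (intro bexI[of _ LZero] exI[of _ "[]"])
      (auto intro: lie_span.zero lie_cong.sym[OF lie_cong.add_zero])
next
  case (base t)
  then consider "t \<in> B" | \<mu> where "\<mu> \<noteq> \<gamma>" "weight_vector h \<mu> t" using assms(2) by blast
  then show ?case
  proof cases
    case 1
    then show ?thesis
      by (intro bexI[of _ t] exI[of _ "[]"])
        (auto intro: lie_span.base lie_cong.sym[OF add_zero_right])
  next
    case 2
    have "t \<approx> LAdd LZero (LAdd t LZero)"
      by (meson lie_cong.sym lie_cong.trans lie_cong.add_zero lie_cong.add_commute)
    then show ?thesis using 2
      by (intro bexI[of _ LZero] exI[of _ "[(\<mu>, t)]"]) (auto intro: lie_span.zero)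
  qed
next
  case (add t t')
  then obtain s s' ps ps' where *: "s \<in> lie_span B" "s' \<in> lie_span B"
    "\<forall>(\<mu>, t)\<in>set ps. \<mu> \<noteq> \<gamma> \<and> weight_vector h \<mu> t" "\<forall>(\<mu>, t)\<in>set ps'. \<mu> \<noteq> \<gamma> \<and> weight_vector h \<mu> t"
    "t \<approx> LAdd s (lie_sum (map snd ps))" "t' \<approx> LAdd s' (lie_sum (map snd ps'))"
    by blast
  then have "LAdd t t' \<approx> LAdd (LAdd s s') (lie_sum (map snd (ps @ ps')))"
    by simp (meson add_cross lie_sum_append lie_cong.cong_add lie_cong.refl lie_cong.sym lie_cong.trans)
  then show ?case using *
    by (intro bexI[of _ "LAdd s s'"] exI[of _ "ps @ ps'"]) (auto intro: lie_span.add)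
next
  case (scale t c)
  then obtain s ps where *: "s \<in> lie_span B"
    "\<forall>(\<mu>, t)\<in>set ps. \<mu> \<noteq> \<gamma> \<and> weight_vector h \<mu> t" "t \<approx> LAdd s (lie_sum (map snd ps))"
    by blast
  let ?qs = "map (\<lambda>(\<mu>, t). (\<mu>, LScale c t)) ps"
  have qs: "map snd ?qs = map (LScale c) (map snd ps)" by (simp add: case_prod_unfold)
  have "LScale c t \<approx> LScale c (LAdd s (lie_sum (map snd ps)))"
    by (rule lie_cong.cong_scale[OF *(3)])
  also have "\<dots> \<approx> LAdd (LScale c s) (LScale c (lie_sum (map snd ps)))"
    by (rule lie_cong.scale_add_right)
  also have "\<dots> \<approx> LAdd (LScale c s) (lie_sum (map snd ?qs))"
    unfolding qs by (rule lie_cong.cong_add[OF lie_cong.refl lie_sum_scale])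
  finally have "LScale c t \<approx> LAdd (LScale c s) (lie_sum (map snd ?qs))" .
  then show ?case using *
    by (intro bexI[of _ "LScale c s"] exI[of _ ?qs]) (auto intro: lie_span.scale weight_vector_scale)
next
  case (cong t s)
  then show ?case by (meson lie_cong.trans)
qed

text \<open>The summands of foreign weight add up to \<open>t - s\<close>, which has weight
  \<gamma>, so their sum vanishes by \<open>weight_sum_zero\<close>. This extracts one weight space
  from a spanning set of weight vectors.\<close>

lemma weight_vector_in_lie_span:
  assumes "t \<in> lie_span A" "\<And>t. t \<in> A \<Longrightarrow> t \<in> B \<or> (\<exists>\<mu>. \<mu> \<noteq> \<gamma> \<and> weight_vector h \<mu> t)"
    and "\<And>s. s \<in> B \<Longrightarrow> weight_vector h \<gamma> s" "weight_vector h \<gamma> t"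
  shows "t \<in> lie_span B"
proof -
  obtain s ps where s: "s \<in> lie_span B"
    and ps: "\<forall>(\<mu>, t)\<in>set ps. \<mu> \<noteq> \<gamma> \<and> weight_vector h \<mu> t"
    and t: "t \<approx> LAdd s (lie_sum (map snd ps))"
    using lie_span_weight_decomposition[OF assms(1,2)] by blast
  let ?r = "lie_sum (map snd ps)"
  have "?r \<approx> LAdd (LAdd (LScale (- 1) s) s) ?r"
    by (meson lie_cong.add_inverse lie_cong.add_zero lie_cong.cong_add lie_cong.refl lie_cong.sym
        lie_cong.trans)
  also have "\<dots> \<approx> LAdd (LScale (- 1) s) t"
    by (meson t lie_cong.add_assoc lie_cong.cong_add lie_cong.refl lie_cong.sym lie_cong.trans)
  finally have "weight_vector h \<gamma> ?r"
    using weight_vector_lie_span[OF s, of h \<gamma>] assms(3,4)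
    by (blast intro: weight_vector_cong weight_vector_add weight_vector_scale)
  then have "?r \<approx> LZero" using ps by (intro weight_sum_zero) auto
  then have "t \<approx> LAdd s LZero"
    using t by (meson lie_cong.cong_add lie_cong.refl lie_cong.trans)
  then show ?thesis using s by (meson lie_span.add lie_span.cong lie_span.zero)
qed

end

section \<open>Acyclic orientations with a unique sink\<close>

text \<open>Edges point from the earlier to the later letter, so the last letter of a distinct word
  is always a sink.\<close>

primrec orient :: "'v set set \<Rightarrow> 'v list \<Rightarrow> ('v \<times> 'v) set" where
  "orient E [] = {}"
| "orient E (x # w) = {(x, y) |y. y \<in> set w \<and> {x, y} \<in> E} \<union> orient E w"

text \<open>Every acyclic orientation of the subgraph induced by \<open>S\<close> is \<open>orient E w\<close> for an enumeration \<open>w\<close>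
  of \<open>S\<close>; the condition on out-neighbours says that no vertex other than \<open>a\<close> is a sink.\<close>

definition rooted_orientations :: "'v set set \<Rightarrow> 'v \<Rightarrow> 'v set \<Rightarrow> ('v \<times> 'v) set set" where
  "rooted_orientations E a S =
    {orient E w |w. distinct w \<and> set w = S \<and> (\<forall>y\<in>S - {a}. \<exists>z. (y, z) \<in> orient E w)}"

lemma orient_append:
  "orient E (p @ q) = orient E p \<union> orient E q \<union> {(x, y). x \<in> set p \<and> y \<in> set q \<and> {x, y} \<in> E}"
  by (induction p) auto

lemma orient_subset: "orient E w \<subseteq> set w \<times> set w"
  by (induction w) auto

lemma orient_edge: "(x, y) \<in> orient E w \<Longrightarrow> {x, y} \<in> E"
  by (induction w) auto

lemma orient_total:
  "x \<in> set w \<Longrightarrow> y \<in> set w \<Longrightarrow> x \<noteq> y \<Longrightarrow> {x, y} \<in> E \<Longrightarrow> (x, y) \<in> orient E w \<or> (y, x) \<in> orient E w"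
  by (induction w) (auto simp: insert_commute)

lemma orient_filter: "orient E (filter P w) = orient E w \<inter> {x. P x} \<times> {x. P x}"
  using orient_subset[of E] by (induction w) auto

text \<open>Index of the first occurrence of \<open>y\<close>, with default value
  \<open>length w\<close> if there is none. It increases along arcs and so witnesses
  acyclicity.\<close>

definition position :: "'v list \<Rightarrow> 'v \<Rightarrow> nat" where
  "position w y = length (takeWhile (\<lambda>z. z \<noteq> y) w)"

lemma position_less_of_orient: "distinct w \<Longrightarrow> (x, y) \<in> orient E w \<Longrightarrow> position w x < position w y"
proof (induction w)
  case (Cons z w)
  then show ?case using orient_subset[of E w] by (auto simp: position_def)
qed simp

lemma position_le_length: "position w y \<le> length w"
  by (simp add: position_def length_takeWhile_le)

lemma position_le_of_reach:
  assumes "(x, y) \<in> (orient E w)\<^sup>*" "distinct w"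
  shows "position w x \<le> position w y"
  using assms(1)
proof (induction rule: rtrancl_induct)
  case (step y z)
  then show ?case using position_less_of_orient[OF assms(2), of y z] by fastforce
qed simp

text \<open>Each arc raises the position, which is bounded by \<open>length w\<close>. Following
  arcs must therefore stop, and \<open>a\<close> is the only vertex where it can.\<close>

lemma reach_root:
  assumes w: "distinct w" and out: "\<forall>y\<in>set w - {a}. \<exists>z. (y, z) \<in> orient E w"
    and "y \<in> set w"
  shows "(y, a) \<in> (orient E w)\<^sup>*"
  using assms(3)
proof (induction "length w - position w y" arbitrary: y rule: less_induct)
  case less
  show ?case
  proof (cases "y = a")
    case False
    then obtain z where z: "(y, z) \<in> orient E w" using out less.prems by blast
    then have "z \<in> set w" using orient_subset[of E w] by blast
    moreover have "length w - position w z < length w - position w y"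
      using position_less_of_orient[OF w z] position_le_length[of w z] by linarith
    ultimately have "(z, a) \<in> (orient E w)\<^sup>*" using less.hyps by blast
    then show ?thesis using z by (meson converse_rtrancl_into_rtrancl)
  qed simp
qed

lemma card_rooted_orientations_singleton: 
  assumes "{a} \<notin> E"
  shows "card (rooted_orientations E a {a}) = 1"
proof -
  have "rooted_orientations E a {a} = {{}}"
  proof
    have "orient E w = {}" if "set w = {a}" for w
      using orient_subset[of E w] orient_edge[of a a E w] that assms by auto
    then show "rooted_orientations E a {a} \<subseteq> {{}}"
      unfolding rooted_orientations_def by blast
    show "{{}} \<subseteq> rooted_orientations E a {a}"
      by (auto simp: rooted_orientations_def intro!: exI[of _ "[a]"])
  qed
  then show ?thesis by simp
qed

text \<open>Every vertex reaches \<open>a\<close> along arcs, and reachability along undirected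
  edges is symmetric. Read backwards, disconnected sets have count 0.\<close>

lemma connected_in_of_rooted_orientation:
  assumes "O' \<in> rooted_orientations E a S" "a \<in> S"
  shows "connected_in E S"
proof -
  let ?D = "{(x, y). x \<in> S \<and> y \<in> S \<and> {x, y} \<in> E}"
  obtain w where w: "distinct w" "set w = S" "\<forall>y\<in>S - {a}. \<exists>z. (y, z) \<in> orient E w"
    using assms(1) unfolding rooted_orientations_def by blast
  have "orient E w \<subseteq> ?D" using orient_subset[of E w] orient_edge[of _ _ E w] w(2) by auto
  then have to_root: "(y, a) \<in> ?D\<^sup>*" if "y \<in> S" for y
    using reach_root[of w a E y] w that rtrancl_mono by blast
  have "sym ?D" by (auto simp: sym_def insert_commute)
  then have "sym (?D\<^sup>*)" by (rule sym_rtrancl)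
  then have "(u, v) \<in> ?D\<^sup>*" if "u \<in> S" "v \<in> S" for u v
    using to_root[OF that(1)] to_root[OF that(2)] by (meson rtrancl_trans symD)
  then show ?thesis using assms(2) unfolding connected_in_def by blast
qed

text \<open>For an edge \<open>{a, b}\<close>, an orientation with unique sink \<open>a\<close> is split along the set of
  vertices from which \<open>b\<close> can be reached: this set has unique sink \<open>b\<close>, and all edges between it
  and its complement leave it.\<close>

lemma card_rooted_orientations_split:
  fixes S :: "'v::finite set"
  assumes ab: "{a, b} \<in> E" "a \<in> S" "b \<in> S" "a \<noteq> b"
  shows "card (rooted_orientations E a S) =
    (\<Sum>T\<in>{T. T \<subseteq> S \<and> a \<in> T \<and> b \<notin> T}.
      card (rooted_orientations E a T) * card (rooted_orientations E b (S - T)))"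
proof -
  let ?I = "{T. T \<subseteq> S \<and> a \<in> T \<and> b \<notin> T}"
  let ?Sig = "SIGMA T:?I. rooted_orientations E a T \<times> rooted_orientations E b (S - T)"
  define cross where "cross T = {(x, y). x \<in> S - T \<and> y \<in> T \<and> {x, y} \<in> E}" for T
  define f where "f = (\<lambda>(T, P, Q). P \<union> Q \<union> cross T)"
  have sub: "P \<subseteq> T \<times> T" if "P \<in> rooted_orientations E c T" for P c T
    using that orient_subset[of E] unfolding rooted_orientations_def by blast
  \<comment> \<open>The three components can be read off the glued orientation, which gives
    injectivity of \<open>f\<close>. Since arcs between the parts only enter \<open>T\<close>, no
    vertex of \<open>T\<close> reaches \<open>b\<close>.\<close>
  have recover: "S - T = {v \<in> S. (v, b) \<in> (f (T, P, Q))\<^sup>*}"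
      "P = f (T, P, Q) \<inter> T \<times> T" "Q = f (T, P, Q) \<inter> (S - T) \<times> (S - T)"
    if "(T, P, Q) \<in> ?Sig" for T P Q
  proof -
    have T: "T \<subseteq> S" "a \<in> T" "b \<notin> T" and P: "P \<in> rooted_orientations E a T"
      and Q: "Q \<in> rooted_orientations E b (S - T)"
      using that by auto
    show "P = f (T, P, Q) \<inter> T \<times> T" "Q = f (T, P, Q) \<inter> (S - T) \<times> (S - T)"
      using sub[OF P] sub[OF Q] by (auto simp: f_def cross_def)
    have stay: "v \<in> T" if "(u, v) \<in> (f (T, P, Q))\<^sup>*" "u \<in> T" for u v
      using that
    proof (induction rule: rtrancl_induct)
      case (step y z)
      then show ?case using sub[OF P] sub[OF Q] by (auto simp: f_def cross_def)
    qed
    obtain w where w: "distinct w" "set w = S - T" "Q = orient E w"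
      "\<forall>y\<in>S - T - {b}. \<exists>z. (y, z) \<in> orient E w"
      using Q unfolding rooted_orientations_def by blast
    have "(v, b) \<in> (f (T, P, Q))\<^sup>*" if "v \<in> S - T" for v
    proof -
      have "(v, b) \<in> Q\<^sup>*" using reach_root[of w b E v] w that by simp
      moreover have "Q \<subseteq> f (T, P, Q)" by (auto simp: f_def)
      ultimately show ?thesis using rtrancl_mono by blast
    qed
    then show "S - T = {v \<in> S. (v, b) \<in> (f (T, P, Q))\<^sup>*}"
      using stay[of _ b] T by blast
  qed
  have inj: "inj_on f ?Sig"
  proof (rule inj_onI)
    fix X Y assume XY: "X \<in> ?Sig" "Y \<in> ?Sig" "f X = f Y"
    obtain T P Q where X: "X = (T, P, Q)" by (cases X) auto
    obtain T' P' Q' where Y: "Y = (T', P', Q')" by (cases Y) auto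
    have "S - T = S - T'"
      using recover(1)[of T P Q] recover(1)[of T' P' Q'] XY X Y by simp
    moreover have "T \<subseteq> S" "T' \<subseteq> S" using XY X Y by auto
    ultimately have "T = T'" by blast
    then show "X = Y"
      using recover(2,3)[of T P Q] recover(2,3)[of T' P' Q'] XY X Y by simp
  qed
  have image: "f ` ?Sig = rooted_orientations E a S"
  proof
    show "f ` ?Sig \<subseteq> rooted_orientations E a S"
    proof clarify
      fix T P Q
      assume T: "T \<subseteq> S" "a \<in> T" "b \<notin> T" and P: "P \<in> rooted_orientations E a T"
        and Q: "Q \<in> rooted_orientations E b (S - T)"
      obtain w where w: "distinct w" "set w = T" "P = orient E w"
        "\<forall>y\<in>T - {a}. \<exists>z. (y, z) \<in> orient E w"
        using P unfolding rooted_orientations_def by blast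
      obtain w' where w': "distinct w'" "set w' = S - T" "Q = orient E w'"
        "\<forall>y\<in>S - T - {b}. \<exists>z. (y, z) \<in> orient E w'"
        using Q unfolding rooted_orientations_def by blast
      have eq: "f (T, P, Q) = orient E (w' @ w)"
        using w w' by (auto simp: orient_append f_def cross_def)
      \<comment> \<open>The edge \<open>{a, b}\<close> gives \<open>b\<close> an out-neighbour, so
        the sink of the second part is not a sink of the whole.\<close>
      have "(b, a) \<in> orient E (w' @ w)"
        using ab T w w' by (auto simp: orient_append insert_commute)
      then have "\<forall>y\<in>S - {a}. \<exists>z. (y, z) \<in> orient E (w' @ w)"
        using w(4) w'(4) by (auto simp: orient_append; blast)
      moreover have "distinct (w' @ w)" "set (w' @ w) = S" using w w' T by auto
      ultimately show "f (T, P, Q) \<in> rooted_orientations E a S"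
        unfolding eq rooted_orientations_def by blast
    qed
    show "rooted_orientations E a S \<subseteq> f ` ?Sig"
    proof
      fix X assume "X \<in> rooted_orientations E a S"
      then obtain w where w: "distinct w" "set w = S" "X = orient E w"
        and out: "\<forall>y\<in>S - {a}. \<exists>z. (y, z) \<in> X"
        unfolding rooted_orientations_def by blast
      define T where "T = {v \<in> S. (v, b) \<notin> X\<^sup>*}"
      have subX: "X \<subseteq> S \<times> S" using w orient_subset[of E w] by simp
      have TX: "y \<in> T" if "(x, y) \<in> X" "x \<in> T" for x y
        using that subX by (auto simp: T_def intro: converse_rtrancl_into_rtrancl)
      have ba: "(b, a) \<in> X\<^sup>*" using reach_root[of w a E b] w out ab by simp
      \<comment> \<open>Together with \<open>ba\<close> this would close a cycle, although positions
        grow along arcs.\<close>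
      have "(a, b) \<notin> X\<^sup>*"
      proof
        assume "(a, b) \<in> X\<^sup>*"
        then have "(a, b) \<in> X\<^sup>+" using ab(4) by (simp add: rtrancl_eq_or_trancl)
        then obtain z where z: "(a, z) \<in> X" "(z, b) \<in> X\<^sup>*" by (meson tranclD)
        have "position w a < position w z" using position_less_of_orient w z(1) by metis
        moreover have "position w z \<le> position w b" "position w b \<le> position w a"
          using position_le_of_reach w ba z(2) by metis+
        ultimately show False by simp
      qed
      then have T: "T \<in> ?I" using ab by (auto simp: T_def)
      let ?P = "orient E (filter (\<lambda>x. x \<in> T) w)" and ?Q = "orient E (filter (\<lambda>x. x \<notin> T) w)"
      have P_eq: "?P = X \<inter> T \<times> T" and Q_eq: "?Q = X \<inter> (S - T) \<times> (S - T)"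
        using subX w(3) by (auto simp: orient_filter)
      have "\<exists>z. (y, z) \<in> ?P" if "y \<in> T - {a}" for y
      proof -
        have "y \<in> S - {a}" using that by (auto simp: T_def)
        then obtain z where "(y, z) \<in> X" using out by blast
        then show ?thesis using TX that unfolding P_eq by blast
      qed
      moreover have "set (filter (\<lambda>x. x \<in> T) w) = T" using w(2) T by auto
      moreover have "distinct (filter (\<lambda>x. x \<in> T) w)" using w(1) by simp
      ultimately have P: "?P \<in> rooted_orientations E a T"
        unfolding rooted_orientations_def by blast
      have "\<exists>z. (y, z) \<in> ?Q" if "y \<in> S - T - {b}" for y
      proof -
        have "(y, b) \<in> X\<^sup>*" "y \<noteq> b" using that by (auto simp: T_def)
        then obtain z where "(y, z) \<in> X" "(z, b) \<in> X\<^sup>*" by (meson converse_rtranclE)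
        then show ?thesis using that subX unfolding Q_eq by (auto simp: T_def)
      qed
      moreover have "set (filter (\<lambda>x. x \<notin> T) w) = S - T" using w(2) by auto
      moreover have "distinct (filter (\<lambda>x. x \<notin> T) w)" using w(1) by simp
      ultimately have Q: "?Q \<in> rooted_orientations E b (S - T)"
        unfolding rooted_orientations_def by blast
      have "X = ?P \<union> ?Q \<union> cross T"
      proof
        show "X \<subseteq> ?P \<union> ?Q \<union> cross T"
        proof clarify
          fix x y assume xy: "(x, y) \<in> X" "(x, y) \<notin> cross T" "(x, y) \<notin> ?Q"
          have "x \<in> S" "y \<in> S" using xy(1) subX by auto
          moreover have "{x, y} \<in> E" using xy(1) orient_edge[of x y E w] w(3) by simp
          ultimately show "(x, y) \<in> ?P"
            using xy TX[of x y] unfolding P_eq Q_eq cross_def by auto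
        qed
        have "(x, y) \<in> X" if "(x, y) \<in> cross T" for x y
        proof -
          have xy: "x \<in> S - T" "y \<in> T" "{x, y} \<in> E" using that by (auto simp: cross_def)
          then have "y \<in> S" "x \<noteq> y" using T by auto
          then have "(x, y) \<in> X \<or> (y, x) \<in> X"
            using orient_total[of x w y E] xy w by simp
          then show ?thesis using TX xy by blast
        qed
        then show "?P \<union> ?Q \<union> cross T \<subseteq> X" unfolding P_eq Q_eq by auto
      qed
      then have "X = f (T, ?P, ?Q)" by (simp add: f_def)
      moreover have "(T, ?P, ?Q) \<in> ?Sig" using T P Q by blast
      ultimately show "X \<in> f ` ?Sig" by (rule image_eqI)
    qed
  qed
  have "card (rooted_orientations E a S) = card ?Sig"
    unfolding image[symmetric] by (rule card_image[OF inj])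
  also have "\<dots> = (\<Sum>T\<in>?I. card (rooted_orientations E a T \<times> rooted_orientations E b (S - T)))"
    by (rule card_SigmaI) auto
  finally show ?thesis by (simp add: card_cartesian_product)
qed

text \<open>Summing the splitting identity over both directions of all edges inside \<open>S\<close> gives the
  recursion; every splitting into \<open>T\<close> and \<open>S - T\<close> occurs twice on the right-hand side.\<close>

lemma edges_in_recursion:
  fixes E :: "'v::finite set set" and m :: "'v set \<Rightarrow> nat"
  assumes E: "simple_graph E"
    and m: "\<And>S a. a \<in> S \<Longrightarrow> m S = card (rooted_orientations E a S)"
  shows "2 * edges_in E S * m S = (\<Sum>T\<in>Pow S. edges_between E T (S - T) * (m T * m (S - T)))"
proof -
  \<comment> \<open>For the two-element sets \<open>e\<close> considered here: exactly one end of
    \<open>e\<close> lies in \<open>T\<close>.\<close>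
  define cuts where "cuts e T \<longleftrightarrow> T \<inter> e \<noteq> {} \<and> \<not> e \<subseteq> T" for e T :: "'v set"
  let ?F = "{e \<in> E. e \<subseteq> S}"
  have between: "edges_between E T (S - T) = card {e \<in> ?F. cuts e T}" if "T \<subseteq> S" for T
  proof -
    have "{e \<in> E. \<exists>u\<in>T. \<exists>v\<in>S - T. e = {u, v}} = {e \<in> ?F. cuts e T}"
    proof (rule Set.set_eqI)
      fix e
      show "e \<in> {e \<in> E. \<exists>u\<in>T. \<exists>v\<in>S - T. e = {u, v}} \<longleftrightarrow> e \<in> {e \<in> ?F. cuts e T}"
      proof (cases "e \<in> E")
        case True
        then obtain x y where "e = {x, y}" "x \<noteq> y"
          using E unfolding simple_graph_def by (meson card_2_iff)
        then show ?thesis using True that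
          by (auto simp: cuts_def doubleton_eq_iff)
      qed simp
    qed
    then show ?thesis unfolding edges_between_def by (rule arg_cong)
  qed
  have edge: "(\<Sum>T\<in>{T \<in> Pow S. cuts e T}. m T * m (S - T)) = 2 * m S" if "e \<in> ?F" for e
  proof -
    have "card e = 2" using E that by (simp add: simple_graph_def)
    then obtain a b where e: "e = {a, b}" "a \<noteq> b" by (auto simp: card_2_iff)
    \<comment> \<open>As \<open>m\<close> may be computed with any sink, the splitting identity is
      applied with sink \<open>c\<close> for \<open>S\<close> and \<open>T\<close> and with sink
      \<open>d\<close> for \<open>S - T\<close>, where \<open>c\<close> and \<open>d\<close> are the
      ends of \<open>e\<close>.\<close>
    have half: "(\<Sum>T\<in>{T. T \<subseteq> S \<and> c \<in> T \<and> d \<notin> T}. m T * m (S - T)) = m S"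
      if "{c, d} = e" "c \<noteq> d" for c d
    proof -
      have cd: "{c, d} \<in> E" "c \<in> S" "d \<in> S" using that \<open>e \<in> ?F\<close> by auto
      show ?thesis
        unfolding m[OF cd(2)] card_rooted_orientations_split[OF cd that(2)]
        using cd by (intro sum.cong) (auto simp: m[of c] m[of d])
    qed
    have "{T \<in> Pow S. cuts e T} = {T. T \<subseteq> S \<and> a \<in> T \<and> b \<notin> T} \<union> {T. T \<subseteq> S \<and> b \<in> T \<and> a \<notin> T}"
      by (auto simp: cuts_def e)
    then have "(\<Sum>T\<in>{T \<in> Pow S. cuts e T}. m T * m (S - T)) =
        (\<Sum>T\<in>{T. T \<subseteq> S \<and> a \<in> T \<and> b \<notin> T}. m T * m (S - T)) +
        (\<Sum>T\<in>{T. T \<subseteq> S \<and> b \<in> T \<and> a \<notin> T}. m T * m (S - T))"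
      by (simp only:) (rule sum.union_disjoint; auto)
    then show ?thesis using half[of a b] half[of b a] e by (simp add: insert_commute)
  qed
  have "(\<Sum>T\<in>Pow S. edges_between E T (S - T) * (m T * m (S - T))) =
      (\<Sum>T\<in>Pow S. \<Sum>e\<in>?F. if cuts e T then m T * m (S - T) else 0)"
  proof (rule sum.cong)
    fix T assume "T \<in> Pow S"
    have "(\<Sum>e\<in>?F. if cuts e T then m T * m (S - T) else 0) =
        (\<Sum>e\<in>{e \<in> ?F. cuts e T}. m T * m (S - T))"
      by (rule sum.inter_filter[symmetric]) simp
    then show "edges_between E T (S - T) * (m T * m (S - T)) =
        (\<Sum>e\<in>?F. if cuts e T then m T * m (S - T) else 0)"
      using between[of T] \<open>T \<in> Pow S\<close> by simp
  qed simp
  also have "\<dots> = (\<Sum>e\<in>?F. \<Sum>T\<in>Pow S. if cuts e T then m T * m (S - T) else 0)"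
    by (rule sum.swap)
  also have "\<dots> = (\<Sum>e\<in>?F. 2 * m S)"
  proof (rule sum.cong)
    fix e assume "e \<in> ?F"
    have "(\<Sum>T\<in>Pow S. if cuts e T then m T * m (S - T) else 0) =
        (\<Sum>T\<in>{T \<in> Pow S. cuts e T}. m T * m (S - T))"
      by (rule sum.inter_filter[symmetric]) simp
    then show "(\<Sum>T\<in>Pow S. if cuts e T then m T * m (S - T) else 0) = 2 * m S"
      using edge[OF \<open>e \<in> ?F\<close>] by simp
  qed simp
  also have "\<dots> = 2 * edges_in E S * m S" by (simp add: edges_in_def)
  finally show ?thesis by simp
qed

section \<open>Spanning sets of the root spaces\<close>

primrec ad_word :: "('v \<Rightarrow> 'g) \<Rightarrow> 'v list \<Rightarrow> 'g lie_term \<Rightarrow> 'g lie_term" where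
  "ad_word c [] t = t"
| "ad_word c (i # w) t = LBr (LGen (c i)) (ad_word c w t)"

lemma ad_word_append: "ad_word c (u @ w) t = ad_word c u (ad_word c w t)"
  by (induction u) auto

lemma ad_word_cong: "lie_cong R s t \<Longrightarrow> lie_cong R (ad_word c w s) (ad_word c w t)"
  by (induction w) (auto intro: lie_cong.cong_br lie_cong.refl)

lemma ad_word_zero: "lie_cong R (ad_word c w LZero) LZero"
proof (induction w)
  case Nil
  then show ?case by (simp add: lie_cong.refl)
next
  case (Cons i w)
  then show ?case
    by simp (meson br_zero_right lie_cong.cong_br lie_cong.refl lie_cong.trans)
qed

lemma ad_word_lie_span:
  assumes "t \<in> lie_span R A" "\<And>s. s \<in> A \<Longrightarrow> ad_word c w s \<in> lie_span R B"
  shows "ad_word c w t \<in> lie_span R B"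
proof -
  have "ad_word c w t \<in> lie_span R (ad_word c w ` A)"
  proof (induction w)
    case Nil
    then show ?case using assms(1) by simp
  next
    case (Cons i w)
    show ?case
      by simp (rule br_lie_span_right[OF _ Cons], auto intro: lie_span.base)
  qed
  then show ?thesis using lie_span_least[of "ad_word c w ` A" R B] assms(2) by blast
qed

text \<open>The adjoint action of an iterated bracket is an iterated commutator, which expands into
  words with the same letters. Only the multiset of letters is recorded, since the order is
  immaterial for the later use.\<close>

lemma br_ad_word_in_lie_span:
  "LBr (ad_word c u (LGen (c b))) t \<in> lie_span R {ad_word c v t |v. mset v = mset (u @ [b])}"
proof (induction u arbitrary: t)
  case Nil
  show ?case by (intro lie_span.base CollectI exI[of _ "[b]"]) simp
next
  case (Cons i u)
  let ?W = "ad_word c u (LGen (c b))"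
  show ?case
  proof (simp only: ad_word.simps(2), rule br_br_lie_span)
    show "LBr (LGen (c i)) (LBr ?W t) \<in> lie_span R {ad_word c v t |v. mset v = mset ((i # u) @ [b])}"
    proof (rule br_lie_span_right[OF _ Cons.IH])
      fix s assume "s \<in> {ad_word c v t |v. mset v = mset (u @ [b])}"
      then obtain v where "s = ad_word c v t" "mset v = mset (u @ [b])" by blast
      then show "LBr (LGen (c i)) s \<in> lie_span R {ad_word c v t |v. mset v = mset ((i # u) @ [b])}"
        by (intro lie_span.base CollectI exI[of _ "i # v"]) simp
    qed
    \<comment> \<open>In the second Jacobi term the letter \<open>i\<close> acts first, so it ends
      up at the right end of the word.\<close>
    have "{ad_word c v (LBr (LGen (c i)) t) |v. mset v = mset (u @ [b])} \<subseteq>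
        {ad_word c v t |v. mset v = mset ((i # u) @ [b])}"
    proof clarify
      fix v assume "mset v = mset (u @ [b])"
      then show "\<exists>v'. ad_word c v (LBr (LGen (c i)) t) = ad_word c v' t \<and>
          mset v' = mset ((i # u) @ [b])"
        by (intro exI[of _ "v @ [i]"]) (simp add: ad_word_append)
    qed
    from lie_span_mono[OF this]
    show "LBr ?W (LBr (LGen (c i)) t) \<in> lie_span R {ad_word c v t |v. mset v = mset ((i # u) @ [b])}"
      using Cons.IH[of "LBr (LGen (c i)) t"] by blast
  qed
qed

text \<open>Cut the word at an occurrence of \<open>a\<close>. Up to sign, the tail starting there
  is \<open>[W, a]\<close> for an iterated bracket \<open>W\<close>, and expanding
  \<open>ad W\<close> leaves \<open>a\<close> as the innermost letter.\<close>

lemma ad_word_change_last: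
  assumes "a \<in> set (u @ [b])"
  shows "ad_word c u (LGen (c b)) \<in>
    lie_span R {ad_word c v (LGen (c a)) |v. mset (v @ [a]) = mset (u @ [b])}"
proof (cases "a = b")
  case True
  then show ?thesis by (intro lie_span.base) auto
next
  case False
  then obtain p q where u: "u = p @ a # q" using assms by (auto dest: split_list)
  let ?A = "{ad_word c v (LGen (c a)) |v. mset v = mset (q @ [b])}"
  have "ad_word c u (LGen (c b)) = ad_word c p (LBr (LGen (c a)) (ad_word c q (LGen (c b))))"
    by (simp add: u ad_word_append)
  also have "\<dots> \<in> lie_span R {ad_word c v (LGen (c a)) |v. mset (v @ [a]) = mset (u @ [b])}"
  proof (rule ad_word_lie_span)
    show "LBr (LGen (c a)) (ad_word c q (LGen (c b))) \<in> lie_span R ?A"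
      by (rule br_lie_span_commute[OF br_ad_word_in_lie_span])
    fix s assume "s \<in> ?A"
    then obtain v where "s = ad_word c v (LGen (c a))" "mset v = mset (q @ [b])" by blast
    then show "ad_word c p s \<in> lie_span R {ad_word c v (LGen (c a)) |v. mset (v @ [a]) = mset (u @ [b])}"
      by (intro lie_span.base CollectI exI[of _ "p @ v"]) (simp add: ad_word_append u)
  qed
  finally show ?thesis .
qed

lemma ad_word_weight:
  assumes "\<And>i. weight_vector R h (\<mu> i) (LGen (c i))"
  shows "weight_vector R h (\<lambda>x. \<Sum>i\<leftarrow>u @ [a]. \<mu> i x) (ad_word c u (LGen (c a)))"
  using assms by (induction u) (auto intro: weight_vector_br)

text \<open>The Jacobi identity as the Leibniz rule for \<open>ad x\<close>, the counterpart of
  \<open>br_br_lie_span\<close>.\<close>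

lemma br_in_lie_span_derivation:
  assumes "LBr (LBr x y) z \<in> lie_span R A" "LBr y (LBr x z) \<in> lie_span R A"
  shows "LBr x (LBr y z) \<in> lie_span R A"
proof -
  let ?B = "LBr y (LBr x z)"
  have "LBr x (LBr y z) \<in> lie_span R {LBr (LBr x y) z, ?B}"
  proof (rule lie_span.cong)
    show "LAdd (LBr (LBr x y) z) ?B \<in> lie_span R {LBr (LBr x y) z, ?B}"
      by (intro lie_span.add lie_span.base) auto
    have "lie_cong R (LBr x (LBr y z)) (LAdd (LBr x (LBr y z)) (LAdd (LScale (- 1) ?B) ?B))"
      by (meson add_zero_right lie_cong.add_inverse lie_cong.cong_add lie_cong.refl lie_cong.sym
          lie_cong.trans)
    also have "lie_cong R \<dots> (LAdd (LAdd (LBr x (LBr y z)) (LScale (- 1) ?B)) ?B)"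
      by (rule lie_cong.sym[OF lie_cong.add_assoc])
    also have "lie_cong R \<dots> (LAdd (LBr (LBr x y) z) ?B)"
      by (rule lie_cong.cong_add[OF lie_cong.sym[OF br_br_left] lie_cong.refl])
    finally show "lie_cong R (LBr x (LBr y z)) (LAdd (LBr (LBr x y) z) ?B)" .
  qed
  then show ?thesis using assms lie_span_least[of "{LBr (LBr x y) z, ?B}" R A] by blast
qed

section \<open>The Kac-Moody algebra of a graph and its triangular spanning set\<close>

locale graph_kac_moody =
  fixes E :: "'v::finite set set"
    and hscale :: "complex \<Rightarrow> 'h::ab_group_add \<Rightarrow> 'h"
    and \<alpha> :: "'v \<Rightarrow> 'h \<Rightarrow> complex"
    and coroot :: "'v \<Rightarrow> 'h"
  assumes graph: "simple_graph E"
    and realization: "minimal_realization hscale (cartan_matrix E) \<alpha> coroot"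
begin

abbreviation rel where "rel \<equiv> km_rel hscale (cartan_matrix E) \<alpha> coroot"
abbreviation cong_km (infix "\<approx>" 50) where "s \<approx> t \<equiv> lie_cong rel s t"

lemma no_loop: "{i} \<notin> E"
  using graph by (auto simp: simple_graph_def)

lemma cartan_matrix_nth:
  "cartan_matrix E $ i $ j = (if i = j then 2 else if {i, j} \<in> E then - 1 else 0)"
  using no_loop[of i] by (auto simp: cartan_matrix_def adjacency_matrix_def mat_def)

lemma LH_commute: "LBr (LH x) (LH y) \<approx> LZero"
  by (intro lie_cong.base km_rel.hh)

lemma weight_vector_LH: "weight_vector rel LH (\<lambda>x. 0) (LH y)"
  unfolding weight_vector_def
  by (meson LH_commute lie_cong.sym lie_cong.trans scale_zero_left)

lemma weight_vector_LE: "weight_vector rel LH (\<alpha> i) (LE i)"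
  unfolding weight_vector_def by (intro allI lie_cong.base km_rel.he)

lemma weight_vector_LF: "weight_vector rel LH (\<lambda>x. - \<alpha> i x) (LF i)"
  unfolding weight_vector_def by (intro allI lie_cong.base km_rel.hf)

definition words :: "('v \<Rightarrow> ('h, 'v) km_gen) \<Rightarrow> ('h, 'v) km_gen lie_term set" where
  "words c = {ad_word c u (LGen (c a)) |u a. True}"

lemma gen_in_words: "LGen (c a) \<in> words c"
  unfolding words_def by (intro CollectI exI[of _ "[]"] exI[of _ a]) simp

text \<open>The Cartan part together with the raising and the lowering part, spanned by weight
  vectors. Linear independence is not claimed.\<close>

definition weight_basis :: "('h, 'v) km_gen lie_term set" where
  "weight_basis = range LH \<union> words GenE \<union> words GenF"

lemma words_weight:
  assumes "\<And>i. weight_vector rel LH (\<mu> i) (LGen (c i))" "t \<in> words c"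
  shows "LBr (LH x) t \<in> lie_span rel {t}" "LBr t (LH x) \<in> lie_span rel {t}"
proof -
  obtain u a where "t = ad_word c u (LGen (c a))" using assms(2) by (auto simp: words_def)
  then have "LBr (LH x) t \<approx> LScale (\<Sum>i\<leftarrow>u @ [a]. \<mu> i x) t"
    using ad_word_weight[of rel LH \<mu> c u a] assms(1) unfolding weight_vector_def by blast
  then show "LBr (LH x) t \<in> lie_span rel {t}"
    by (rule lie_span.cong[rotated]) (auto intro: lie_span.intros)
  then show "LBr t (LH x) \<in> lie_span rel {t}" by (rule br_lie_span_commute)
qed

text \<open>Applied both with \<open>c = e\<close>, \<open>d = f\<close> and the other way round.\<close>

lemma opposite_br_word:
  assumes cross: "\<And>i j. LBr (LGen (c i)) (LGen (d j)) \<in> lie_span rel (range LH)"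
    and weight: "\<And>i. weight_vector rel LH (\<mu> i) (LGen (d i))"
  shows "LBr (LGen (c i)) (ad_word d u (LGen (d a))) \<in> lie_span rel (range LH \<union> words d)"
proof (induction u)
  case Nil
  then show ?case using cross[of i a] lie_span_mono[of "range LH" "range LH \<union> words d"] by auto
next
  case (Cons j u)
  let ?W = "ad_word d u (LGen (d a))" and ?D = "lie_span rel (range LH \<union> words d)"
  have W: "?W \<in> words d" by (auto simp: words_def)
  have "LBr ?W (LGen (c i)) \<in> ?D"
    by (rule br_lie_span_commute[OF Cons.IH])
  have step: "LBr (LGen (d j)) s \<in> ?D" if "s \<in> range LH \<union> words d" for s
  proof -
    have "LBr (LGen (d j)) (LH x) \<in> ?D" for x
    proof -
      have d: "LGen (d j) \<in> words d" by (rule gen_in_words)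
      then have "{LGen (d j)} \<subseteq> range LH \<union> words d" by blast
      from lie_span_mono[OF this] words_weight(2)[OF weight d] show ?thesis by blast
    qed
    moreover have "LBr (LGen (d j)) (ad_word d v (LGen (d b))) \<in> ?D" for v b
      by (intro lie_span.base UnI2) (auto simp: words_def intro!: exI[of _ "j # v"])
    ultimately show ?thesis using that by (auto simp: words_def)
  qed
  \<comment> \<open>The inner bracket lies in the Cartan part, and bracketing the weight vector
    \<open>?W\<close> with that part gives multiples of \<open>?W\<close>.\<close>
  have "LBr ?W (LBr (LGen (c i)) (LGen (d j))) \<in> ?D"
  proof (rule br_lie_span_right[OF _ cross])
    fix s :: "('h, 'v) km_gen lie_term" assume "s \<in> range LH"
    moreover have "{?W} \<subseteq> range LH \<union> words d" using W by blast
    ultimately show "LBr ?W s \<in> ?D"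
      using lie_span_mono[of "{?W}" "range LH \<union> words d"] words_weight(2)[OF weight W] by blast
  qed
  then have "LBr (LBr (LGen (c i)) (LGen (d j))) ?W \<in> ?D"
    by (rule br_lie_span_commute)
  moreover have "LBr (LGen (d j)) (LBr (LGen (c i)) ?W) \<in> ?D"
    by (rule br_lie_span_right[OF step Cons.IH])
  ultimately show ?case
    by (simp only: ad_word.simps(2)) (rule br_in_lie_span_derivation)
qed

lemma br_LE_LF: "LBr (LE i) (LF j) \<in> lie_span rel (range LH)"
proof (cases "i = j")
  case True
  have "LBr (LE i) (LF i) \<approx> LH (coroot i)" by (intro lie_cong.base km_rel.ef_same)
  then show ?thesis using True by (auto intro: lie_span.cong[OF lie_span.base])
next
  case False
  then have "LBr (LE i) (LF j) \<approx> LZero" by (intro lie_cong.base km_rel.ef_diff)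
  then show ?thesis by (rule lie_span.cong[OF lie_span.zero])
qed

text \<open>The spanning half of the triangular decomposition: a generator \<open>e\<close> or
  \<open>f\<close> lengthens words of its own kind, while \<open>opposite_br_word\<close> treats
  words of the other kind.\<close>

lemma weight_basis_spans: "t \<in> lie_span rel weight_basis"
proof (rule lie_span_UNIV)
  have mono: "s \<in> lie_span rel weight_basis" if "s \<in> lie_span rel A" "A \<subseteq> weight_basis" for s A
    using that lie_span_mono by blast
  have W: "words GenE \<subseteq> weight_basis" "words GenF \<subseteq> weight_basis"
    by (auto simp: weight_basis_def)
  have wordE: "LBr (LE i) t \<in> words GenE" if t: "t \<in> words GenE" for i t
  proof -
    obtain u a where "t = ad_word GenE u (LE a)" using t by (auto simp: words_def)
    then have "LBr (LE i) t = ad_word GenE (i # u) (LE a)" by simp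
    then show ?thesis unfolding words_def by blast
  qed
  have wordF: "LBr (LF i) t \<in> words GenF" if t: "t \<in> words GenF" for i t
  proof -
    obtain u a where "t = ad_word GenF u (LF a)" using t by (auto simp: words_def)
    then have "LBr (LF i) t = ad_word GenF (i # u) (LF a)" by simp
    then show ?thesis unfolding words_def by blast
  qed
  show "LBr (LGen g) t \<in> lie_span rel weight_basis" if t: "t \<in> weight_basis" for g t
  proof (cases g)
    case (GenH x)
    consider y where "t = LH y" | "t \<in> words GenE" | "t \<in> words GenF"
      using t by (auto simp: weight_basis_def)
    then show ?thesis
    proof cases
      case 1
      then show ?thesis using GenH LH_commute lie_span.cong lie_span.zero by blast
    next
      case 2
      then show ?thesis
        using GenH words_weight(1)[where c = GenE and t = t and x = x, OF weight_vector_LE] mono[of _ "{t}"] t by blast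
    next
      case 3
      then show ?thesis
        using GenH words_weight(1)[where c = GenF and t = t and x = x, OF weight_vector_LF] mono[of _ "{t}"] t by blast
    qed
  next
    case (GenE i)
    consider y where "t = LH y" | "t \<in> words GenE" | u a where "t = ad_word GenF u (LF a)"
      using t by (auto simp: weight_basis_def words_def)
    then show ?thesis
    proof cases
      case 1
      then show ?thesis
        using GenE words_weight(2)[where c = GenE, OF weight_vector_LE gen_in_words[of GenE i]] mono[of _ "{LE i}"]
          gen_in_words[of GenE i] W by blast
    next
      case 2
      then show ?thesis using GenE wordE W by (blast intro: lie_span.base)
    next
      case 3
      have "LBr (LE i) t \<in> lie_span rel (range LH \<union> words GenF)"
        unfolding 3 by (rule opposite_br_word[OF br_LE_LF weight_vector_LF])
      then show ?thesis unfolding GenE by (rule mono) (auto simp: weight_basis_def)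
    qed
  next
    case (GenF i)
    consider y where "t = LH y" | "t \<in> words GenF" | u a where "t = ad_word GenE u (LE a)"
      using t by (auto simp: weight_basis_def words_def)
    then show ?thesis
    proof cases
      case 1
      then show ?thesis
        using GenF words_weight(2)[where c = GenF, OF weight_vector_LF gen_in_words[of GenF i]] mono[of _ "{LF i}"]
          gen_in_words[of GenF i] W by blast
    next
      case 2
      then show ?thesis using GenF wordF W by (blast intro: lie_span.base)
    next
      case 3
      have "LBr (LF i) t \<in> lie_span rel (range LH \<union> words GenE)"
        unfolding 3
        by (rule opposite_br_word[OF br_lie_span_commute[OF br_LE_LF] weight_vector_LE])
      then show ?thesis unfolding GenF by (rule mono) (auto simp: weight_basis_def)
    qed
  qed
  show "LGen g \<in> lie_span rel weight_basis" for g
    using gen_in_words[of GenE] gen_in_words[of GenF]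
    by (cases g) (auto simp: weight_basis_def intro: lie_span.base)
qed

section \<open>Weights of words\<close>

lemma sum_list_roots:
  "(\<Sum>i\<leftarrow>w. \<alpha> i x) = (\<Sum>i\<in>UNIV. of_nat (count (mset w) i) * \<alpha> i x)"
proof (induction w)
  case (Cons j w)
  have "(\<Sum>i\<in>UNIV. of_nat (count (mset (j # w)) i) * \<alpha> i x) =
      (\<Sum>i\<in>UNIV. (if i = j then \<alpha> i x else 0) + of_nat (count (mset w) i) * \<alpha> i x)"
    by (intro sum.cong) (auto simp: algebra_simps)
  then show ?case using Cons by (simp add: sum.distrib)
qed simp

lemma root_sum_eq: "root_sum \<alpha> S x = (\<Sum>i\<in>UNIV. (if i \<in> S then 1 else 0) * \<alpha> i x)"
  unfolding root_sum_def by (simp add: if_distrib[of "\<lambda>z. z * _"] sum.If_cases cong: if_cong)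

text \<open>By linear independence of the simple roots, the weight determines how often each letter
  occurs; for \<open>root_sum \<alpha> S\<close> these numbers are 0 or 1.\<close>

lemma weight_of_word:
  assumes "(\<lambda>x. \<Sum>i\<leftarrow>w. \<alpha> i x) = root_sum \<alpha> S"
  shows "distinct w" "set w = S"
proof -
  interpret minimal_realization hscale "cartan_matrix E" \<alpha> coroot by (rule realization)
  have "of_nat (count (mset w) i) - (if i \<in> S then 1 else 0) = (0 :: complex)" for i
  proof (rule roots_independent)
    fix x
    have "(\<Sum>i\<leftarrow>w. \<alpha> i x) - root_sum \<alpha> S x = 0" using fun_cong[OF assms, of x] by simp
    then show "(\<Sum>i\<in>UNIV. (of_nat (count (mset w) i) - (if i \<in> S then 1 else 0)) * \<alpha> i x) = 0"
      unfolding sum_list_roots root_sum_eq by (simp add: sum_subtractf left_diff_distrib)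
  qed
  then have "of_nat (count (mset w) i) = (of_nat (if i \<in> S then 1 else 0) :: complex)" for i
    by (metis eq_iff_diff_eq_0 of_nat_0 of_nat_1)
  then have c: "count (mset w) i = (if i \<in> S then 1 else 0)" for i
    using of_nat_eq_iff by blast
  have "i \<in> set w \<longleftrightarrow> i \<in> S" for i
    using c[of i] by (metis count_eq_zero_iff set_mset_mset zero_neq_one)
  then show "set w = S" by blast
  then show "distinct w" unfolding distinct_count_atmost_1 using c by auto
qed

text \<open>Independence of the roots would give \<open>count + 1 = 0\<close> for a letter of
  \<open>S\<close>, impossible in characteristic zero.\<close>

lemma neg_weight_of_word:
  assumes "(\<lambda>x. \<Sum>i\<leftarrow>w. - \<alpha> i x) = root_sum \<alpha> S"
  shows "S = {}"
proof -
  interpret minimal_realization hscale "cartan_matrix E" \<alpha> coroot by (rule realization)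
  have *: "of_nat (count (mset w) i) + (if i \<in> S then 1 else 0) = (0 :: complex)" for i
  proof (rule roots_independent)
    fix x
    have "(\<Sum>i\<leftarrow>w. - \<alpha> i x) = - (\<Sum>i\<leftarrow>w. \<alpha> i x)" by (induction w) auto
    then have "(\<Sum>i\<leftarrow>w. \<alpha> i x) + root_sum \<alpha> S x = 0" using fun_cong[OF assms, of x] by simp
    then show "(\<Sum>i\<in>UNIV. (of_nat (count (mset w) i) + (if i \<in> S then 1 else 0)) * \<alpha> i x) = 0"
      unfolding sum_list_roots root_sum_eq by (simp add: sum.distrib distrib_right)
  qed
  have "i \<notin> S" for i
  proof
    assume "i \<in> S"
    then have "of_nat (Suc (count (mset w) i)) = (0 :: complex)" using *[of i] by (simp add: add.commute)
    then show False by (simp only: of_nat_eq_0_iff)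
  qed
  then show ?thesis by blast
qed

text \<open>In \<open>weight_basis\<close> only the \<open>e\<close>-words that enumerate
  \<open>S\<close> have this weight, and \<open>ad_word_change_last\<close> makes all of them end in
  \<open>a\<close>.\<close>

lemma root_vector_in_lie_span:
  assumes t: "weight_vector rel LH (root_sum \<alpha> S) t" and a: "a \<in> S"
  shows "t \<in> lie_span rel {ad_word GenE u (LE a) |u. distinct (u @ [a]) \<and> set (u @ [a]) = S}"
proof -
  let ?B = "{ad_word GenE u (LE b) |u b. distinct (u @ [b]) \<and> set (u @ [b]) = S}"
  have B: "weight_vector rel LH (root_sum \<alpha> S) s" if s: "s \<in> ?B" for s
  proof -
    obtain u b where s: "s = ad_word GenE u (LE b)" "distinct (u @ [b])" "set (u @ [b]) = S"
      using s by blast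
    then have "root_sum \<alpha> S = (\<lambda>x. \<Sum>i\<leftarrow>u @ [b]. \<alpha> i x)"
      unfolding root_sum_def by (metis sum_list_distinct_conv_sum_set)
    then show ?thesis using ad_word_weight[where c = GenE and u = u and a = b, OF weight_vector_LE] s(1) by simp
  qed
  have "t \<in> lie_span rel ?B"
  proof (rule weight_vector_in_lie_span[OF weight_basis_spans _ B t])
    fix s assume "s \<in> weight_basis"
    then consider x where "s = LH x" | u b where "s = ad_word GenE u (LE b)"
      | u b where "s = ad_word GenF u (LF b)"
      by (auto simp: weight_basis_def words_def)
    then show "s \<in> ?B \<or> (\<exists>\<mu>. \<mu> \<noteq> root_sum \<alpha> S \<and> weight_vector rel LH \<mu> s)"
    proof cases
      case 1
      have "(\<lambda>x. 0) \<noteq> root_sum \<alpha> S"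
        using weight_of_word(2)[of "[]" S] a by auto
      then show ?thesis using 1 weight_vector_LH by blast
    next
      case 2
      show ?thesis
      proof (cases "(\<lambda>x. \<Sum>i\<leftarrow>u @ [b]. \<alpha> i x) = root_sum \<alpha> S")
        case True
        then show ?thesis using weight_of_word[OF True] 2 by blast
      next
        case False
        then show ?thesis using ad_word_weight[where c = GenE and u = u and a = b, OF weight_vector_LE] 2 by blast
      qed
    next
      case 3
      have "(\<lambda>x. \<Sum>i\<leftarrow>u @ [b]. - \<alpha> i x) \<noteq> root_sum \<alpha> S"
        using neg_weight_of_word[of "u @ [b]" S] a by blast
      then show ?thesis using ad_word_weight[where c = GenF and u = u and a = b, OF weight_vector_LF] 3 by blast
    qed
  qed
  moreover have "?B \<subseteq> lie_span rel {ad_word GenE u (LE a) |u. distinct (u @ [a]) \<and> set (u @ [a]) = S}"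
  proof clarify
    fix u b assume u: "distinct (u @ [b])" "S = set (u @ [b])"
    have "{ad_word GenE v (LE a) |v. mset (v @ [a]) = mset (u @ [b])} \<subseteq>
        {ad_word GenE v (LE a) |v. distinct (v @ [a]) \<and> set (v @ [a]) = set (u @ [b])}"
    proof
      fix s assume "s \<in> {ad_word GenE v (LE a) |v. mset (v @ [a]) = mset (u @ [b])}"
      then obtain v where v: "s = ad_word GenE v (LE a)" "mset (v @ [a]) = mset (u @ [b])" by blast
      have "distinct (v @ [a])" "set (v @ [a]) = set (u @ [b])"
        using u(1) mset_eq_imp_distinct_iff[OF v(2)] mset_eq_setD[OF v(2)] by blast+
      then show "s \<in> {ad_word GenE v (LE a) |v. distinct (v @ [a]) \<and> set (v @ [a]) = set (u @ [b])}"
        using v(1) by blast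
    qed
    from lie_span_mono[OF this] ad_word_change_last[of a u b GenE rel] a u(2)
    show "ad_word GenE u (LE b) \<in> lie_span rel
        {ad_word GenE v (LE a) |v. distinct (v @ [a]) \<and> set (v @ [a]) = set (u @ [b])}"
      by blast
  qed
  ultimately show ?thesis using lie_span_least by blast
qed

section \<open>Partial commutation of the generators \<open>e\<close>\<close>

lemma LE_commute:
  assumes "i \<noteq> j" "{i, j} \<notin> E"
  shows "LBr (LE i) (LE j) \<approx> LZero"
proof -
  have "(LBr (LE i) ^^ nat (1 - cartan_matrix E $ i $ j)) (LE j) \<approx> LZero"
    using assms(1) by (intro lie_cong.base km_rel.serre_e)
  \<comment> \<open>The Cartan entry is 0, so the Serre exponent is 1.\<close>
  then show ?thesis using assms by (simp add: cartan_matrix_nth)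
qed

lemma LE_ad_word_commute:
  assumes "\<And>y. y \<in> set p \<Longrightarrow> x \<noteq> y \<and> {x, y} \<notin> E"
  shows "LBr (LE x) (ad_word GenE p t) \<approx> ad_word GenE p (LBr (LE x) t)"
  using assms
proof (induction p)
  case Nil
  then show ?case by (simp add: lie_cong.refl)
next
  case (Cons y p)
  have "LBr (LE x) (LBr (LE y) (ad_word GenE p t)) \<approx> LBr (LE y) (LBr (LE x) (ad_word GenE p t))"
    using Cons.prems[of y] by (intro br_commute_of_zero LE_commute) auto
  also have "\<dots> \<approx> LBr (LE y) (ad_word GenE p (LBr (LE x) t))"
    using Cons by (intro lie_cong.cong_br lie_cong.refl) auto
  finally show ?case by simp
qed

text \<open>The head \<open>x\<close> of \<open>u\<close> has no incoming arc. Hence no letter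
  before \<open>x\<close> in \<open>u'\<close> is adjacent to \<open>x\<close>, and \<open>x\<close>
  can be commuted to the front of \<open>u'\<close>.\<close>

lemma ad_word_orient_cong:
  assumes "distinct u" "distinct u'" "set u = set u'" "orient E u = orient E u'"
  shows "ad_word GenE u t \<approx> ad_word GenE u' t"
  using assms
proof (induction u arbitrary: u')
  case Nil
  then show ?case by (simp add: lie_cong.refl)
next
  case (Cons x u)
  then obtain p q where u': "u' = p @ x # q" by (metis list.set_intros(1) split_list)
  have x: "x \<notin> set u" "x \<notin> set p" "x \<notin> set q" using Cons.prems u' by auto
  have nonadjacent: "x \<noteq> y \<and> {x, y} \<notin> E" if "y \<in> set p" for y
  proof -
    have "{x, y} \<in> E \<Longrightarrow> (y, x) \<in> orient E (x # u)"
      unfolding Cons.prems(4) u' using that by (auto simp: orient_append insert_commute)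
    moreover have "y \<noteq> x" using that x by blast
    ultimately show ?thesis using orient_subset[of E u] x(1) by auto
  qed
  have f: "filter (\<lambda>y. y \<noteq> x) (x # u) = u" "filter (\<lambda>y. y \<noteq> x) u' = p @ q"
  proof -
    have "filter (\<lambda>y. y \<noteq> x) w = w" if "x \<notin> set w" for w
      using that by (auto simp: filter_id_conv)
    then show "filter (\<lambda>y. y \<noteq> x) (x # u) = u" "filter (\<lambda>y. y \<noteq> x) u' = p @ q"
      using x by (simp_all add: u')
  qed
  \<comment> \<open>Deleting \<open>x\<close> restricts both orientations in the same way, so the
    induction hypothesis applies to what remains.\<close>
  have "orient E u = orient E (p @ q)"
    using orient_filter[of E "\<lambda>y. y \<noteq> x" "x # u"] orient_filter[of E "\<lambda>y. y \<noteq> x" u']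
    unfolding f Cons.prems(4) by simp
  moreover have "set u = set (p @ q)"
    using arg_cong[OF Cons.prems(3), of "\<lambda>A. A - {x}"] x by (auto simp: u')
  ultimately have "ad_word GenE u t \<approx> ad_word GenE (p @ q) t"
    using Cons.prems(1,2) by (intro Cons.IH) (auto simp: u')
  then have "ad_word GenE (x # u) t \<approx> LBr (LE x) (ad_word GenE p (ad_word GenE q t))"
    by (simp add: ad_word_append lie_cong.cong_br lie_cong.refl)
  also have "\<dots> \<approx> ad_word GenE p (LBr (LE x) (ad_word GenE q t))"
    by (rule LE_ad_word_commute[OF nonadjacent])
  finally show ?case by (simp add: u' ad_word_append)
qed

text \<open>A sink \<open>y\<close> is adjacent to no later letter, so it commutes inwards up to
  \<open>[e_y, e_a]\<close>, which is zero.\<close>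

lemma ad_word_extra_sink:
  assumes "distinct (u @ [a])" "y \<in> set u" "\<And>z. (y, z) \<notin> orient E (u @ [a])"
  shows "ad_word GenE u (LE a) \<approx> LZero"
proof -
  obtain p q where u: "u = p @ y # q" using assms(2) by (meson split_list)
  have nonadjacent: "y \<noteq> z \<and> {y, z} \<notin> E" if "z \<in> set (q @ [a])" for z
    using assms(1) assms(3)[of z] that by (auto simp: u orient_append)
  have "LBr (LE y) (ad_word GenE q (LE a)) \<approx> ad_word GenE q (LBr (LE y) (LE a))"
    using nonadjacent by (intro LE_ad_word_commute) auto
  also have "\<dots> \<approx> ad_word GenE q LZero"
    using nonadjacent by (intro ad_word_cong LE_commute) auto
  also have "\<dots> \<approx> LZero" by (rule ad_word_zero)
  finally have "ad_word GenE p (LBr (LE y) (ad_word GenE q (LE a))) \<approx> ad_word GenE p LZero"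
    by (rule ad_word_cong)
  also have "\<dots> \<approx> LZero" by (rule ad_word_zero)
  finally show ?thesis by (simp add: u ad_word_append)
qed

text \<open>The final letter \<open>a\<close> is left out because it enters as the innermost
  generator. By \<open>ad_word_orient_cong\<close> the choice does not affect the resulting bracket
  up to congruence.\<close>

definition root_word :: "'v \<Rightarrow> 'v set \<Rightarrow> ('v \<times> 'v) set \<Rightarrow> 'v list" where
  "root_word a S X = (SOME u. distinct (u @ [a]) \<and> set (u @ [a]) = S \<and> orient E (u @ [a]) = X)"

text \<open>Existence for the choice: the last letter of an enumeration is a sink, hence equal to
  \<open>a\<close>.\<close>

lemma root_word:
  assumes "X \<in> rooted_orientations E a S" "a \<in> S"
  shows "distinct (root_word a S X @ [a])" "set (root_word a S X @ [a]) = S"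
    "orient E (root_word a S X @ [a]) = X"
proof -
  obtain w where w: "distinct w" "set w = S" "X = orient E w"
    "\<forall>y\<in>S - {a}. \<exists>z. (y, z) \<in> orient E w"
    using assms(1) unfolding rooted_orientations_def by blast
  then obtain u b where u: "w = u @ [b]" using assms(2) by (cases w rule: rev_cases) auto
  have "b \<notin> set u" using w(1) u by simp
  then have "(b, z) \<notin> orient E w" for z
    using orient_subset[of E u] unfolding u orient_append by auto
  then have "b = a" using w u by auto
  then have "\<exists>u. distinct (u @ [a]) \<and> set (u @ [a]) = S \<and> orient E (u @ [a]) = X"
    using w u by blast
  from someI_ex[OF this]
  show "distinct (root_word a S X @ [a])" "set (root_word a S X @ [a]) = S"
    "orient E (root_word a S X @ [a]) = X"
    unfolding root_word_def by blast+
qed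

abbreviation root_vector :: "'v \<Rightarrow> 'v set \<Rightarrow> ('v \<times> 'v) set \<Rightarrow> ('h, 'v) km_gen lie_term" where
  "root_vector a S X \<equiv> ad_word GenE (root_word a S X) (LE a)"

lemma weight_vector_root_vector:
  assumes "X \<in> rooted_orientations E a S" "a \<in> S"
  shows "weight_vector rel LH (root_sum \<alpha> S) (root_vector a S X)"
proof -
  have "root_sum \<alpha> S = (\<lambda>x. \<Sum>i\<leftarrow>root_word a S X @ [a]. \<alpha> i x)"
    unfolding root_sum_def using root_word[OF assms] by (metis sum_list_distinct_conv_sum_set)
  then show ?thesis using ad_word_weight[where c = GenE and u = "root_word a S X" and a = a, OF weight_vector_LE] by simp
qed

text \<open>Words with the same orientation give congruent brackets, and an additional sink gives
  zero, so one word per rooted orientation suffices. This is the upper bound for the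
  multiplicity.\<close>

lemma root_vectors_span:
  assumes "weight_vector rel LH (root_sum \<alpha> S) t" "a \<in> S"
  shows "t \<in> lie_span rel (root_vector a S ` rooted_orientations E a S)"
proof (rule lie_span_least[OF _ root_vector_in_lie_span[OF assms]], clarify)
  fix u assume u: "distinct (u @ [a])" "S = set (u @ [a])"
  let ?X = "orient E (u @ [a])"
  show "ad_word GenE u (LE a) \<in> lie_span rel
      (root_vector a (set (u @ [a])) ` rooted_orientations E a (set (u @ [a])))"
    unfolding u(2)[symmetric]
  proof (cases "\<forall>y\<in>S - {a}. \<exists>z. (y, z) \<in> ?X")
    case True
    then have X: "?X \<in> rooted_orientations E a S"
      using u unfolding rooted_orientations_def by blast
    let ?v = "root_word a S ?X"
    note v = root_word[OF X assms(2)]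
    have f: "filter (\<lambda>y. y \<noteq> a) (w @ [a]) = w" if "distinct (w @ [a])" for w
      using that by (simp add: filter_id_conv) blast
    have "orient E u = orient E ?v"
      using orient_filter[of E "\<lambda>y. y \<noteq> a" "u @ [a]"] orient_filter[of E "\<lambda>y. y \<noteq> a" "?v @ [a]"]
      unfolding f[OF u(1)] f[OF v(1)] v(3) by simp
    moreover have "set u = set ?v" using u v(1,2) by auto
    ultimately have "ad_word GenE u (LE a) \<approx> root_vector a S ?X"
      using u(1) v(1) by (intro ad_word_orient_cong) auto
    then show "ad_word GenE u (LE a) \<in> lie_span rel (root_vector a S ` rooted_orientations E a S)"
      using X by (intro lie_span.cong[OF lie_span.base]) auto
  next
    case False
    then obtain y where "y \<in> S - {a}" "\<And>z. (y, z) \<notin> ?X" by blast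
    then have "ad_word GenE u (LE a) \<approx> LZero"
      using u by (intro ad_word_extra_sink[of u a y]) auto
    then show "ad_word GenE u (LE a) \<in> lie_span rel (root_vector a S ` rooted_orientations E a S)"
      by (rule lie_span.cong[OF lie_span.zero])
  qed
qed

end

section \<open>A representation on functions of words\<close>

context graph_kac_moody
begin

abbreviation wt :: "'v list \<Rightarrow> 'h \<Rightarrow> complex" where
  "wt w x \<equiv> (\<Sum>i\<leftarrow>w. \<alpha> i x)"

primrec act_F :: "'v \<Rightarrow> 'v list \<Rightarrow> ('v list \<Rightarrow> complex) \<Rightarrow> complex" where
  "act_F j [] \<phi> = 0"
| "act_F j (i # w) \<phi> =
    act_F j w (\<lambda>u. \<phi> (i # u)) - (if i = j then wt w (coroot j) * \<phi> w else 0)"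

text \<open>The representation is the dual of the Verma module of lowest weight \<open>0\<close>, realised on the free
  associative algebra: \<open>e\<^sub>i\<close> is dual to multiplication by the letter \<open>i\<close>, and the formula for
  \<open>f\<^sub>j\<close> is forced by \<open>[e\<^sub>i, f\<^sub>j] = \<delta>\<^sub>i\<^sub>j coroot i\<close> and by \<open>f\<^sub>j\<close> vanishing on the empty word.\<close>

primrec act_gen :: "('h, 'v) km_gen \<Rightarrow> ('v list \<Rightarrow> complex) \<Rightarrow> 'v list \<Rightarrow> complex" where
  "act_gen (GenH x) = (\<lambda>\<phi> w. - wt w x * \<phi> w)"
| "act_gen (GenE i) = (\<lambda>\<phi> w. \<phi> (i # w))"
| "act_gen (GenF j) = (\<lambda>\<phi> w. act_F j w \<phi>)"

text \<open>Terms act, not classes: on arbitrary functions of words the \<open>e\<close> satisfy no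
  Serre relations. Invariance under congruence is proved in \<open>act_cong\<close> for
  \<open>serre_compatible\<close> functions.\<close>

primrec act :: "('h, 'v) km_gen lie_term \<Rightarrow> ('v list \<Rightarrow> complex) \<Rightarrow> 'v list \<Rightarrow> complex" where
  "act LZero = (\<lambda>\<phi> w. 0)"
| "act (LGen g) = act_gen g"
| "act (LAdd s t) = (\<lambda>\<phi> w. act s \<phi> w + act t \<phi> w)"
| "act (LScale c t) = (\<lambda>\<phi> w. c * act t \<phi> w)"
| "act (LBr s t) = (\<lambda>\<phi> w. act s (act t \<phi>) w - act t (act s \<phi>) w)"

lemma act_F_linear:
  "act_F j w (\<lambda>u. a * \<phi> u + b * \<psi> u) = a * act_F j w \<phi> + b * act_F j w \<psi>"
  by (induction w arbitrary: \<phi> \<psi>) (simp_all add: algebra_simps)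

lemma act_linear:
  "act t (\<lambda>u. a * \<phi> u + b * \<psi> u) = (\<lambda>w. a * act t \<phi> w + b * act t \<psi> w)"
proof (induction t arbitrary: \<phi> \<psi>)
  case (LGen g)
  then show ?case by (cases g) (simp_all add: act_F_linear algebra_simps)
next
  case (LBr s t)
  show ?case unfolding act.simps LBr.IH by (simp add: algebra_simps)
qed (simp_all add: algebra_simps)

lemma act_add: "act t (\<lambda>u. \<phi> u + \<psi> u) = (\<lambda>w. act t \<phi> w + act t \<psi> w)"
  using act_linear[of t 1 \<phi> 1 \<psi>] by simp

lemma act_diff: "act t (\<lambda>u. \<phi> u - \<psi> u) = (\<lambda>w. act t \<phi> w - act t \<psi> w)"
  using act_linear[of t 1 \<phi> "- 1" \<psi>] by simp

lemma act_scale: "act t (\<lambda>u. a * \<phi> u) = (\<lambda>w. a * act t \<phi> w)"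
  using act_linear[of t a \<phi> 0 \<phi>] by simp

lemma act_zero: "act t (\<lambda>u. 0) = (\<lambda>w. 0)"
  using act_scale[of t 0] by simp

section \<open>Commutation rules of the operators\<close>

lemma root_linear_add: "\<alpha> i (x + y) = \<alpha> i x + \<alpha> i y"
proof -
  interpret minimal_realization hscale "cartan_matrix E" \<alpha> coroot by (rule realization)
  interpret l: Vector_Spaces.linear hscale "(*)" "\<alpha> i" by (rule root_linear)
  show ?thesis by (rule l.add)
qed

lemma root_linear_scale: "\<alpha> i (hscale c x) = c * \<alpha> i x"
proof -
  interpret minimal_realization hscale "cartan_matrix E" \<alpha> coroot by (rule realization)
  interpret l: Vector_Spaces.linear hscale "(*)" "\<alpha> i" by (rule root_linear)
  show ?thesis by (rule l.scale)
qed

lemma pairing_nth: "\<alpha> j (coroot i) = (if i = j then 2 else if {i, j} \<in> E then - 1 else 0)"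
proof -
  interpret minimal_realization hscale "cartan_matrix E" \<alpha> coroot by (rule realization)
  show ?thesis unfolding pairing cartan_matrix_nth by simp
qed

lemma wt_add: "wt w (x + y) = wt w x + wt w y"
  by (induction w) (simp_all add: root_linear_add algebra_simps)

lemma wt_scale: "wt w (hscale c x) = c * wt w x"
  by (induction w) (simp_all add: root_linear_scale algebra_simps)

text \<open>\<open>act_F i w\<close> evaluates its argument only at words obtained from
  \<open>w\<close> by deleting one letter \<open>i\<close>, and these have weight
  \<open>wt w - \<alpha> i\<close>.\<close>

lemma act_F_wt: "act_F i w (\<lambda>u. wt u x * \<phi> u) = (wt w x - \<alpha> i x) * act_F i w \<phi>"
proof (induction w arbitrary: \<phi>)
  case (Cons j w)
  have "act_F i w (\<lambda>u. wt (j # u) x * \<phi> (j # u)) =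
      act_F i w (\<lambda>u. \<alpha> j x * \<phi> (j # u) + 1 * (wt u x * \<phi> (j # u)))"
    by (simp add: algebra_simps)
  also have "\<dots> = \<alpha> j x * act_F i w (\<lambda>u. \<phi> (j # u)) + (wt w x - \<alpha> i x) * act_F i w (\<lambda>u. \<phi> (j # u))"
    unfolding act_F_linear Cons.IH by simp
  finally have eq: "act_F i w (\<lambda>u. wt (j # u) x * \<phi> (j # u)) = \<dots>" .
  show ?case unfolding act_F.simps(2) eq by (simp add: algebra_simps)
qed simp

lemma act_LF_LH:
  "act (LF i) (act (LH x) \<phi>) = (\<lambda>w. act (LH x) (act (LF i) \<phi>) w + \<alpha> i x * act (LF i) \<phi> w)"
proof
  fix w
  have "act_F i w (\<lambda>u. - 1 * (wt u x * \<phi> u) + 0 * \<phi> u) = - 1 * ((wt w x - \<alpha> i x) * act_F i w \<phi>)"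
    unfolding act_F_linear act_F_wt by simp
  then show "act (LF i) (act (LH x) \<phi>) w = act (LH x) (act (LF i) \<phi>) w + \<alpha> i x * act (LF i) \<phi> w"
    by (simp add: algebra_simps)
qed

lemma act_LE_LF:
  "act (LE k) (act (LF i) \<phi>) =
    (\<lambda>w. act (LF i) (act (LE k) \<phi>) w + (if k = i then act (LH (coroot i)) \<phi> w else 0))"
  by (auto simp: fun_eq_iff)

section \<open>The Serre relations in the representation\<close>

abbreviation serre :: "('v \<Rightarrow> ('h, 'v) km_gen) \<Rightarrow> 'v \<Rightarrow> 'v \<Rightarrow> ('h, 'v) km_gen lie_term" where
  "serre c i j \<equiv> (LBr (LGen (c i)) ^^ nat (1 - cartan_matrix E $ i $ j)) (LGen (c j))"

lemma serre_eq:
  assumes "i \<noteq> j"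
  shows "serre c i j = (if {i, j} \<in> E then LBr (LGen (c i)) (LBr (LGen (c i)) (LGen (c j)))
    else LBr (LGen (c i)) (LGen (c j)))"
  using assms by (simp add: cartan_matrix_nth numeral_2_eq_2)

text \<open>The classical fact that every \<open>e\<close> commutes with the Serre elements in the
  \<open>f\<close>, checked on operators from the rules for \<open>[e, f]\<close> and
  \<open>[h, f]\<close> and the Cartan integers.\<close>

lemma act_LE_serre_F:
  assumes "i \<noteq> j"
  shows "act (LE k) (act (serre GenF i j) \<phi>) = act (serre GenF i j) (act (LE k) \<phi>)"
proof -
  have ji: "{j, i} = {i, j}" by blast
  show ?thesis
    using assms
    unfolding serre_eq[OF assms]
    by (cases "k = i"; cases "k = j"; cases "{i, j} \<in> E")
      (simp_all add: act_add act_diff act_LE_LF act_LF_LH act_scale pairing_nth ji algebra_simps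
        del: act.simps(2))
qed

text \<open>The value at \<open>k # w\<close> is the value at \<open>w\<close> after applying
  \<open>LE k\<close>, which commutes with the Serre element. This reduces everything to the empty
  word, where each \<open>f\<close> vanishes.\<close>

lemma act_serre_F_zero:
  assumes "i \<noteq> j"
  shows "act (serre GenF i j) \<phi> w = 0"
proof (induction w arbitrary: \<phi>)
  case Nil
  then show ?case unfolding serre_eq[OF assms] by simp
next
  case (Cons k w)
  have "act (serre GenF i j) \<phi> (k # w) = act (LE k) (act (serre GenF i j) \<phi>) w"
    by simp
  also have "\<dots> = 0" unfolding act_LE_serre_F[OF assms] by (rule Cons)
  finally show ?case .
qed

text \<open>The expanded Serre element in the \<open>e\<close>, applied to \<phi>. The letters are
  reversed because applying \<open>LE j\<close> and then \<open>LE i\<close> to \<phi> gives \<phi>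
  at \<open>j # i # w\<close>.\<close>

definition serre_defect :: "'v \<Rightarrow> 'v \<Rightarrow> ('v list \<Rightarrow> complex) \<Rightarrow> 'v list \<Rightarrow> complex" where
  "serre_defect i j \<phi> w =
    (if {i, j} \<in> E then \<phi> (j # i # i # w) - 2 * \<phi> (i # j # i # w) + \<phi> (i # i # j # w)
     else \<phi> (j # i # w) - \<phi> (i # j # w))"

text \<open>Functions of words are functionals on the free associative algebra; these are the ones
  that kill the two-sided ideal generated by the Serre elements. The prefix \<open>u\<close>
  accounts for left multiples, the suffix \<open>w\<close> for right multiples.\<close>

definition serre_compatible :: "('v list \<Rightarrow> complex) \<Rightarrow> bool" where
  "serre_compatible \<phi> \<longleftrightarrow> (\<forall>u w i j. i \<noteq> j \<longrightarrow> serre_defect i j (\<lambda>v. \<phi> (u @ v)) w = 0)"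

lemma serre_compatibleD: "serre_compatible \<phi> \<Longrightarrow> i \<noteq> j \<Longrightarrow> serre_defect i j \<phi> w = 0"
  unfolding serre_compatible_def by (drule spec[of _ "[]"]) simp

lemma act_serre_E: "i \<noteq> j \<Longrightarrow> act (serre GenE i j) \<phi> w = serre_defect i j \<phi> w"
  by (simp add: serre_eq serre_defect_def)

lemma serre_defect_linear:
  "serre_defect i j (\<lambda>v. a * \<phi> v + b * \<psi> v) w = a * serre_defect i j \<phi> w + b * serre_defect i j \<psi> w"
  by (simp add: serre_defect_def algebra_simps)

text \<open>The length condition selects, among the five words listed, those that occur in the
  current case of \<open>serre_defect\<close>.\<close>

lemma serre_defect_wt:
  assumes "\<And>v. v \<in> {j # i # i # w, i # j # i # w, i # i # j # w, j # i # w, i # j # w} \<Longrightarrow>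
    length v = length w + (if {i, j} \<in> E then 3 else 2) \<Longrightarrow> c v = d"
  shows "serre_defect i j (\<lambda>v. c v * \<phi> v) w = d * serre_defect i j \<phi> w"
  using assms by (simp add: serre_defect_def algebra_simps)

lemma serre_defect_root:
  "serre_defect i j (\<lambda>v. wt (u @ v) x * \<phi> v) w =
    (wt u x + wt w x + \<alpha> i x + \<alpha> j x + (if {i, j} \<in> E then \<alpha> i x else 0)) * serre_defect i j \<phi> w"
  by (intro serre_defect_wt) (auto split: if_splits)

text \<open>The mirror image of \<open>act_LE_serre_F\<close>: every \<open>f\<close> commutes with
  the Serre operators in the \<open>e\<close>.\<close>

lemma act_F_serre_defect:
  assumes "i \<noteq> j"
  shows "serre_defect i j (\<lambda>v. act_F k v \<phi>) w = act_F k w (serre_defect i j \<phi>)"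
proof -
  have ji: "{j, i} = {i, j}" by blast
  have diff: "act_F k w (\<lambda>v. \<phi> v - \<psi> v) = act_F k w \<phi> - act_F k w \<psi>" for k \<phi> \<psi>
    using act_F_linear[of k w 1 \<phi> "- 1" \<psi>] by simp
  have add: "act_F k w (\<lambda>v. \<phi> v + \<psi> v) = act_F k w \<phi> + act_F k w \<psi>" for k \<phi> \<psi>
    using act_F_linear[of k w 1 \<phi> 1 \<psi>] by simp
  have scale: "act_F k w (\<lambda>v. a * \<phi> v) = a * act_F k w \<phi>" for k a \<phi>
    using act_F_linear[of k w a \<phi> 0 \<phi>] by simp
  show ?thesis
    using assms unfolding serre_defect_def
    by (cases "k = i"; cases "k = j"; cases "{i, j} \<in> E")
      (simp_all add: diff add scale pairing_nth ji algebra_simps)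
qed

lemma serre_compatible_linear:
  assumes "serre_compatible \<phi>" "serre_compatible \<psi>"
  shows "serre_compatible (\<lambda>v. a * \<phi> v + b * \<psi> v)"
  using assms unfolding serre_compatible_def by (simp add: serre_defect_linear)

lemma serre_compatible_shift: "serre_compatible \<phi> \<Longrightarrow> serre_compatible (\<lambda>v. \<phi> (a # v))"
  unfolding serre_compatible_def by (simp only: append_Cons[symmetric] simp_thms) blast

lemma serre_compatible_wt:
  "serre_compatible \<phi> \<Longrightarrow> serre_compatible (\<lambda>v. wt v x * \<phi> v)"
  unfolding serre_compatible_def serre_defect_root by simp

text \<open>Induction on the prefix: the empty one is \<open>act_F_serre_defect\<close>, and each
  further letter adds at most a multiple of \<phi> by a weight, which
  \<open>serre_defect_root\<close> controls.\<close>

lemma serre_compatible_act_F: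
  assumes "serre_compatible \<phi>"
  shows "serre_compatible (\<lambda>v. act_F k v \<phi>)"
  unfolding serre_compatible_def
proof (intro allI impI)
  fix u w and i j :: 'v
  assume ij: "i \<noteq> j"
  show "serre_defect i j (\<lambda>v. act_F k (u @ v) \<phi>) w = 0"
    using assms
  proof (induction u arbitrary: \<phi>)
    case Nil
    have "serre_defect i j \<phi> = (\<lambda>v. 0)"
      using serre_compatibleD[OF Nil ij] by (intro ext)
    then show ?case
      using act_F_linear[of k w 0 \<phi> 0 \<phi>] by (simp add: act_F_serre_defect[OF ij])
  next
    case (Cons a u)
    have "serre_defect i j (\<lambda>v. wt (u @ v) (coroot k) * \<phi> (u @ v)) w = 0"
      unfolding serre_defect_root using Cons.prems ij by (simp add: serre_compatible_def)
    then have "serre_defect i j (\<lambda>v. 1 * act_F k (u @ v) (\<lambda>w. \<phi> (a # w)) +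
        (if a = k then - 1 else 0) * (wt (u @ v) (coroot k) * \<phi> (u @ v))) w = 0"
      unfolding serre_defect_linear using Cons.IH[OF serre_compatible_shift[OF Cons.prems]] by simp
    then show ?case by (cases "a = k") simp_all
  qed
qed

lemma serre_compatible_act: "serre_compatible \<phi> \<Longrightarrow> serre_compatible (act t \<phi>)"
proof (induction t arbitrary: \<phi>)
  case LZero
  then show ?case using serre_compatible_linear[of \<phi> \<phi> 0 0] by simp
next
  case (LGen g)
  then show ?case
    using serre_compatible_linear[OF serre_compatible_wt serre_compatible_wt, of \<phi> \<phi> "- 1" _ 0]
    by (cases g) (simp_all add: serre_compatible_shift serre_compatible_act_F)
next
  case (LAdd s t)
  then show ?case using serre_compatible_linear[of "act s \<phi>" "act t \<phi>" 1 1] by simp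
next
  case (LScale c t)
  then show ?case using serre_compatible_linear[of "act t \<phi>" "act t \<phi>" c 0] by simp
next
  case (LBr s t)
  then show ?case
    using serre_compatible_linear[of "act s (act t \<phi>)" "act t (act s \<phi>)" 1 "- 1"] by simp
qed

lemma act_km_rel:
  assumes "rel s t" "serre_compatible \<phi>"
  shows "act s \<phi> = act t \<phi>"
  using assms(1)
proof (cases rule: km_rel.cases)
  case (h_add x y)
  then show ?thesis by (simp add: wt_add algebra_simps)
next
  case (h_scale c x)
  then show ?thesis by (simp add: wt_scale algebra_simps)
next
  case (hh x y)
  then show ?thesis by (simp add: algebra_simps)
next
  case (ef_same i)
  then show ?thesis by (simp add: fun_eq_iff)
next
  case (ef_diff i j)
  then show ?thesis by (simp add: fun_eq_iff)
next
  case (he x i)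
  then show ?thesis by (simp add: algebra_simps)
next
  case (hf x i)
  then show ?thesis using act_LF_LH[of i x \<phi>] by (simp add: fun_eq_iff)
next
  case (serre_e i j)
  have "serre_defect i j \<phi> w = 0" for w
    by (rule serre_compatibleD[OF assms(2) serre_e(3)])
  then show ?thesis using act_serre_E[OF serre_e(3)] unfolding serre_e(1,2) by (simp add: fun_eq_iff)
next
  case (serre_f i j)
  then show ?thesis using act_serre_F_zero[OF serre_f(3)] by (simp add: fun_eq_iff)
qed

text \<open>In a bracket one factor acts on the image of the other, so compatibility has to be
  preserved by \<open>act\<close>.\<close>

lemma act_cong: "s \<approx> t \<Longrightarrow> serre_compatible \<phi> \<Longrightarrow> act s \<phi> = act t \<phi>"
proof (induction arbitrary: \<phi> rule: lie_cong.induct)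
  case (base s t)
  then show ?case by (rule act_km_rel)
next
  case (cong_br s s' t t')
  then show ?case using serre_compatible_act by simp
qed (simp_all add: act_add act_diff act_scale algebra_simps)

text \<open>The representation reads words backwards, hence the reversal.\<close>

definition test_function :: "'v set \<Rightarrow> ('v \<times> 'v) set \<Rightarrow> 'v list \<Rightarrow> complex" where
  "test_function S X w = (if distinct w \<and> set w = S \<and> orient E (rev w) = X then 1 else 0)"

text \<open>For adjacent \<open>i\<close> and \<open>j\<close> every word in the relation repeats
  \<open>i\<close>, so all values are 0. Otherwise exchanging the neighbouring letters
  \<open>i\<close> and \<open>j\<close> changes no arc.\<close>

lemma serre_compatible_test_function: "serre_compatible (test_function S X)"
  unfolding serre_compatible_def
proof (intro allI impI)
  fix u w and i j :: 'v
  assume ij: "i \<noteq> j"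
  show "serre_defect i j (\<lambda>v. test_function S X (u @ v)) w = 0"
  proof (cases "{i, j} \<in> E")
    case True
    then show ?thesis by (simp add: serre_defect_def test_function_def)
  next
    case False
    then have "orient E (rev (u @ i # j # w)) = orient E (rev (u @ j # i # w))"
      by (auto simp: orient_append insert_commute)
    moreover have "set (u @ i # j # w) = set (u @ j # i # w)" by auto
    moreover have "distinct (u @ i # j # w) = distinct (u @ j # i # w)" by auto
    ultimately show ?thesis
      unfolding serre_defect_def test_function_def using False by (simp only: if_False) simp
  qed
qed

text \<open>Reversal turns the head into the last letter, which is a sink and hence must be
  \<open>a\<close>.\<close>

lemma test_function_other_head:
  assumes "X \<in> rooted_orientations E a S" "i \<noteq> a"
  shows "test_function S X (i # w) = 0"
proof (rule ccontr)
  assume "\<not> ?thesis"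
  then have w: "i \<notin> set w" "set (i # w) = S" "orient E (rev w @ [i]) = X"
    unfolding test_function_def by (auto split: if_splits)
  from w(2) have "i \<in> S - {a}" using assms(2) by auto
  then obtain z where "(i, z) \<in> X"
    using assms(1) unfolding rooted_orientations_def by blast
  then show False
    using w(1) orient_subset[of E "rev w"] unfolding w(3)[symmetric] orient_append by auto
qed

text \<open>Of each commutator only the term with \<open>LE i\<close> outermost survives, since
  \<open>LE i\<close> kills \<phi> for every letter \<open>i\<close> of \<open>u\<close>.\<close>

lemma act_ad_word:
  assumes "\<And>i w. i \<noteq> a \<Longrightarrow> \<phi> (i # w) = 0" "a \<notin> set u"
  shows "act (ad_word GenE u (LE a)) \<phi> v = \<phi> (a # rev u @ v)"
  using assms(2)
proof (induction u arbitrary: v)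
  case (Cons i u)
  have "act_gen (GenE i) \<phi> = (\<lambda>u. 0)" using assms(1)[of i] Cons.prems by auto
  then show ?case using Cons by (simp add: act_zero)
qed simp

text \<open>The pairing of root vectors with test functions is the identity matrix, which gives the
  lower bound for the multiplicity.\<close>

lemma act_root_vector:
  assumes "X \<in> rooted_orientations E a S" "Y \<in> rooted_orientations E a S" "a \<in> S"
  shows "act (root_vector a S Y) (test_function S X) [] = (if X = Y then 1 else 0)"
proof -
  note Y = root_word[OF assms(2,3)]
  have "act (root_vector a S Y) (test_function S X) [] =
      test_function S X (rev (root_word a S Y @ [a]))"
    using act_ad_word[of a "test_function S X" "root_word a S Y" "[]"] Y(1)
      test_function_other_head[OF assms(1)] by simp
  then show ?thesis unfolding test_function_def using Y by auto
qed

end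

section \<open>Multiplicities\<close>

text \<open>A spanning family with a biorthogonal family of linear maps is a basis. In the target
  module \<open>N\<close> a vector \<open>e\<close> with zero annihilator takes the place of the
  scalar 1.\<close>

lemma (in vectorspace) dim_of_dual_family:
  assumes "finite I" and b: "\<And>i. i \<in> I \<Longrightarrow> b i \<in> carrier V"
    and f: "\<And>i. i \<in> I \<Longrightarrow> f i \<in> module_hom K V N" and N: "Module.module K N"
    and dual: "\<And>i j. i \<in> I \<Longrightarrow> j \<in> I \<Longrightarrow> f i (b j) = (if i = j then e else \<zero>\<^bsub>N\<^esub>)"
    and e: "\<And>c. c \<in> carrier K \<Longrightarrow> c \<odot>\<^bsub>N\<^esub> e = \<zero>\<^bsub>N\<^esub> \<Longrightarrow> c = \<zero>\<^bsub>K\<^esub>" "e \<in> carrier N" "e \<noteq> \<zero>\<^bsub>N\<^esub>"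
    and gen: "carrier V \<subseteq> span (b ` I)"
  shows "dim = card I"
proof -
  interpret N: Module.module K N by (rule N)
  have inj: "inj_on b I"
    using dual e(3) by (metis inj_onI)
  have B: "b ` I \<subseteq> carrier V" using b by blast
  have "lin_indpt (b ` I)"
  proof (rule finite_lin_indpt2)
    fix c assume c: "c \<in> b ` I \<rightarrow> carrier K" and zero: "lincomb c (b ` I) = \<zero>\<^bsub>V\<^esub>"
    show "\<forall>v\<in>b ` I. c v = \<zero>\<^bsub>K\<^esub>"
    proof clarify
      fix i assume i: "i \<in> I"
      have cI: "c (b j) \<in> carrier K" if "j \<in> I" for j using c that by auto
      interpret h: mod_hom K V N "f i"
        by unfold_locales (rule f[OF i])
      have "f i (lincomb c (b ` I)) = (\<Oplus>\<^bsub>N\<^esub>v\<in>b ` I. f i (c v \<odot>\<^bsub>V\<^esub> v))"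
        unfolding lincomb_def using c B by (intro h.hom_sum) auto
      also have "\<dots> = (\<Oplus>\<^bsub>N\<^esub>v\<in>b ` I. if b i = v then c v \<odot>\<^bsub>N\<^esub> e else \<zero>\<^bsub>N\<^esub>)"
      proof (intro N.finsum_cong' refl)
        fix v assume "v \<in> b ` I"
        then obtain j where j: "j \<in> I" "v = b j" by blast
        have cj: "c (b j) \<in> carrier K" by (rule cI[OF j(1)])
        have "f i (c v \<odot>\<^bsub>V\<^esub> v) = c v \<odot>\<^bsub>N\<^esub> (if i = j then e else \<zero>\<^bsub>N\<^esub>)"
          using h.f_smult[OF cj b[OF j(1)]] dual[OF i j(1)] j(2) by simp
        then show "f i (c v \<odot>\<^bsub>V\<^esub> v) = (if b i = v then c v \<odot>\<^bsub>N\<^esub> e else \<zero>\<^bsub>N\<^esub>)"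
          using inj_onD[OF inj, of i j] i j cj by auto
      qed (use cI e(2) in auto)
      also have "\<dots> = c (b i) \<odot>\<^bsub>N\<^esub> e"
        using i cI e(2) \<open>finite I\<close> by (intro N.finsum_singleton) auto
      finally have "c (b i) \<odot>\<^bsub>N\<^esub> e = \<zero>\<^bsub>N\<^esub>" using zero by simp
      then show "c (b i) = \<zero>\<^bsub>K\<^esub>" using e(1) c i by blast
    qed
  qed (use \<open>finite I\<close> B in auto)
  moreover have "span (b ` I) = carrier V"
    using gen span_is_subset2[OF B] by blast
  ultimately have "dim = card (b ` I)"
    using B \<open>finite I\<close> by (intro dim_basis) (auto simp: basis_def)
  then show ?thesis using card_image[OF inj] by simp
qed

context graph_kac_moody
begin

lemma root_space_eq:
  "root_space hscale (cartan_matrix E) \<alpha> coroot \<gamma> = lie_class rel ` {t. weight_vector rel LH \<gamma> t}"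
  by (rule equalityI; auto simp: root_space_def kac_moody_def presented_lie_algebra_simps weight_vector_def
      lie_class_eq_iff simp del: set_eq_subset del: equalityI)

definition complex_module :: "(complex, complex) module" where
  "complex_module = \<lparr>carrier = UNIV, mult = (*), one = 1, zero = 0, add = (+), smult = (*)\<rparr>"

lemma complex_module_simps:
  "carrier complex_module = UNIV" "\<zero>\<^bsub>complex_module\<^esub> = 0"
  "x \<oplus>\<^bsub>complex_module\<^esub> y = x + y" "x \<odot>\<^bsub>complex_module\<^esub> y = x * y"
  by (simp_all add: complex_module_def)

lemma module_complex_module: "Module.module complex_field complex_module"
proof -
  interpret field complex_field by (rule field_complex_field)
  have "abelian_group complex_module"
    by (intro abelian_groupI)
      (auto simp: complex_module_simps algebra_simps intro: exI[of _ "- x" for x])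
  then show ?thesis
    by (intro moduleI is_cring)
      (auto simp: complex_module_simps complex_field_simps algebra_simps)
qed

text \<open>A functional on classes through a chosen representative; by \<open>act_cong\<close> the
  choice is immaterial for compatible \<phi>.\<close>

definition evaluate :: "('v list \<Rightarrow> complex) \<Rightarrow> ('h, 'v) km_gen lie_term set \<Rightarrow> complex" where
  "evaluate \<phi> C = act (SOME t. t \<in> C) \<phi> []"

lemma evaluate_lie_class:
  assumes "serre_compatible \<phi>"
  shows "evaluate \<phi> (lie_class rel t) = act t \<phi> []"
proof -
  have "t \<approx> (SOME u. u \<in> lie_class rel t)"
    using someI[of "\<lambda>u. u \<in> lie_class rel t" t] lie_cong.refl[of rel t]
    unfolding lie_class_def by simp
  from act_cong[OF this assms] show ?thesis unfolding evaluate_def by simp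
qed

text \<open>The root vectors span the root space and the test functions are dual to them. As the
  left-hand side does not mention \<open>a\<close>, the count is independent of the sink.\<close>

theorem root_mult_eq_card:
  assumes a: "a \<in> S"
  shows "root_mult hscale (cartan_matrix E) \<alpha> coroot (root_sum \<alpha> S) = card (rooted_orientations E a S)"
proof -
  let ?L = "presented_lie_algebra rel" and ?\<gamma> = "root_sum \<alpha> S"
  let ?W = "root_space hscale (cartan_matrix E) \<alpha> coroot ?\<gamma>"
  let ?V = "?L\<lparr>carrier := ?W\<rparr>"
  let ?I = "rooted_orientations E a S"
  let ?b = "\<lambda>X. lie_class rel (root_vector a S X)"
  interpret L: complex_lie_algebra ?L by (rule complex_lie_algebra_presented)
  have sub: "submodule complex_field ?W ?L"
  proof
    show "?W \<subseteq> carrier ?L" by (auto simp: root_space_eq presented_lie_algebra_simps)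
  qed (auto simp: root_space_eq presented_lie_algebra_simps
      intro: weight_vector_add weight_vector_zero weight_vector_scale)
  then have "subspace complex_field ?W ?L"
    by (intro subspace.intro) (rule L.vectorspace_axioms)
  then interpret V: vectorspace complex_field ?V by (rule L.subspace_is_vs)
  have b: "?b X \<in> carrier ?V" if "X \<in> ?I" for X
    using weight_vector_root_vector[OF that a] by (simp add: root_space_eq)
  have "V.dim = card ?I"
  proof (rule V.dim_of_dual_family)
    show "finite ?I" by (rule finite)
    show "?b X \<in> carrier ?V" if "X \<in> ?I" for X by (rule b[OF that])
    show "evaluate (test_function S X) \<in> module_hom complex_field ?V complex_module" for X
      unfolding module_hom_def
      by (auto simp: root_space_eq presented_lie_algebra_simps complex_module_simps
          evaluate_lie_class[OF serre_compatible_test_function])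
    show "Module.module complex_field complex_module" by (rule module_complex_module)
    show "evaluate (test_function S X) (?b Y) = (if X = Y then 1 else \<zero>\<^bsub>complex_module\<^esub>)"
      if "X \<in> ?I" "Y \<in> ?I" for X Y
      using act_root_vector[OF that a]
      by (simp add: evaluate_lie_class[OF serre_compatible_test_function] complex_module_simps)
    show "carrier ?V \<subseteq> V.span (?b ` ?I)"
    proof
      fix C assume "C \<in> carrier ?V"
      then obtain t where t: "C = lie_class rel t" "weight_vector rel LH ?\<gamma> t"
        by (auto simp: root_space_eq)
      have "?b ` ?I \<subseteq> carrier ?V" using b by blast
      then interpret span: submodule complex_field "V.span (?b ` ?I)" ?V
        by (rule V.span_is_submodule)
      have "lie_class rel s \<in> V.span (?b ` ?I)" if "s \<in> lie_span rel (root_vector a S ` ?I)" for s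
        using that
      proof (induction rule: lie_span.induct)
        case zero
        then show ?case using span.zero_closed by (simp add: presented_lie_algebra_simps)
      next
        case (base s)
        then show ?case using V.in_own_span[OF \<open>?b ` ?I \<subseteq> carrier ?V\<close>] by blast
      next
        case (add s t)
        then show ?case
          using span.m_closed[of "lie_class rel s" "lie_class rel t"]
          by (simp add: presented_lie_algebra_simps)
      next
        case (scale s c)
        then show ?case
          using span.smult_closed[of c "lie_class rel s"]
          by (simp add: presented_lie_algebra_simps complex_field_simps)
      next
        case (cong s t)
        then show ?case by (metis lie_class_eq_iff)
      qed
      then show "C \<in> V.span (?b ` ?I)" using root_vectors_span[OF t(2) a] t(1) by blast
    qed
  qed (auto simp: complex_module_simps complex_field_simps)
  then show ?thesis by (simp add: root_mult_def kac_moody_def)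
qed

end

section \<open>Covers in the bond lattice\<close>

lemma block_unique: "partition_on A P \<Longrightarrow> X \<in> P \<Longrightarrow> Y \<in> P \<Longrightarrow> x \<in> X \<Longrightarrow> x \<in> Y \<Longrightarrow> X = Y"
  unfolding partition_on_def disjoint_def by blast

lemma block_exists: "partition_on UNIV P \<Longrightarrow> \<exists>X\<in>P. x \<in> X"
  unfolding partition_on_def by blast

lemma partition_subset_eq:
  assumes P: "partition_on UNIV P" and Q: "partition_on UNIV Q" and sub: "P \<subseteq> Q"
  shows "P = Q"
proof
  show "Q \<subseteq> P"
  proof
    fix Y assume Y: "Y \<in> Q"
    then obtain y where y: "y \<in> Y" using Q unfolding partition_on_def by (metis all_not_in_conv)
    then obtain X where "X \<in> P" "y \<in> X" using block_exists[OF P] by blast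
    then show "Y \<in> P" using block_unique[OF Q Y _ y] sub by blast
  qed
qed (rule sub)

text \<open>A walk inside \<open>S\<close> from \<open>T\<close> to its complement has to leave
  \<open>T\<close> at some edge.\<close>

lemma crossing_edge:
  assumes "connected_in E S" "T \<subset> S" "T \<noteq> {}"
  shows "\<exists>u\<in>T. \<exists>v\<in>S - T. {u, v} \<in> E"
proof (rule ccontr)
  assume no: "\<not> ?thesis"
  obtain x y where xy: "x \<in> T" "y \<in> S" "y \<notin> T" using assms by blast
  let ?D = "{(a, b). a \<in> S \<and> b \<in> S \<and> {a, b} \<in> E}"
  have "(x, y) \<in> ?D\<^sup>*" using assms xy unfolding connected_in_def by blast
  then have "y \<in> T"
  proof (induction rule: rtrancl_induct)
    case (step y z)
    then show ?case using no by blast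
  qed (rule xy)
  then show False using xy by blast
qed

lemma connected_in_union:
  assumes S: "connected_in E S" and T: "connected_in E T" and uv: "u \<in> S" "v \<in> T" "{u, v} \<in> E"
  shows "connected_in E (S \<union> T)"
proof -
  define D where "D A = {(a, b). a \<in> A \<and> b \<in> A \<and> {a, b} \<in> E}" for A
  have mono: "(D A)\<^sup>* \<subseteq> (D (S \<union> T))\<^sup>*" if "A \<subseteq> S \<union> T" for A
    using that by (intro rtrancl_mono) (auto simp: D_def)
  have inside: "(x, y) \<in> (D (S \<union> T))\<^sup>*" if "(x \<in> S \<and> y \<in> S) \<or> (x \<in> T \<and> y \<in> T)" for x y
    using that S T mono[of S] mono[of T] unfolding connected_in_def D_def by blast
  have cross: "(u, v) \<in> (D (S \<union> T))\<^sup>*" "(v, u) \<in> (D (S \<union> T))\<^sup>*"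
    using uv by (auto simp: D_def insert_commute)
  have "(x, y) \<in> (D (S \<union> T))\<^sup>*" if "x \<in> S \<union> T" "y \<in> S \<union> T" for x y
  proof -
    consider "x \<in> S" "y \<in> S" | "x \<in> T" "y \<in> T" | "x \<in> S" "y \<in> T" | "x \<in> T" "y \<in> S"
      using \<open>x \<in> S \<union> T\<close> \<open>y \<in> S \<union> T\<close> by blast
    then show ?thesis
    proof cases
      case 3
      have "(x, u) \<in> (D (S \<union> T))\<^sup>*" by (rule inside) (simp add: 3 uv)
      also note cross(1)
      also have "(v, y) \<in> (D (S \<union> T))\<^sup>*" by (rule inside) (simp add: 3 uv)
      finally show ?thesis .
    next
      case 4
      have "(x, v) \<in> (D (S \<union> T))\<^sup>*" by (rule inside) (simp add: 4 uv)
      also note cross(2)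
      also have "(u, y) \<in> (D (S \<union> T))\<^sup>*" by (rule inside) (simp add: 4 uv)
      finally show ?thesis .
    qed (simp_all add: inside)
  qed
  then show ?thesis using S unfolding connected_in_def D_def by blast
qed

lemma edges_in_pos:
  fixes S :: "'v::finite set"
  assumes "connected_in E S" "card S > 1"
  shows "edges_in E S > 0"
proof -
  obtain x where x: "x \<in> S" using assms(1) unfolding connected_in_def by blast
  moreover have "S \<noteq> {x}" using assms(2) by auto
  ultimately obtain v where "v \<in> S" "{x, v} \<in> E"
    using crossing_edge[OF assms(1), of "{x}"] by blast
  then have "{x, v} \<in> {e \<in> E. e \<subseteq> S}" using x by simp
  then have "{e \<in> E. e \<subseteq> S} \<noteq> {}" by (metis empty_iff)
  then show ?thesis unfolding edges_in_def by (simp add: card_gt_0_iff)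
qed

section \<open>Splitting one block of a partition\<close>

definition split_part :: "'v set set \<Rightarrow> 'v set \<Rightarrow> 'v set \<Rightarrow> 'v set set" where
  "split_part \<pi> S T = insert T (insert (S - T) (\<pi> - {S}))"

text \<open>Splittings are ordered here: \<open>T\<close> and \<open>S - T\<close> both occur. Both
  are non-empty because \<open>connected_in\<close> excludes the empty set.\<close>

definition connected_splits :: "'v set set \<Rightarrow> 'v set \<Rightarrow> 'v set set" where
  "connected_splits E S = {T. T \<subseteq> S \<and> connected_in E T \<and> connected_in E (S - T)}"

lemma connected_splitsD:
  assumes "T \<in> connected_splits E S"
  shows "T \<subseteq> S" "T \<noteq> {}" "S - T \<noteq> {}" "T \<noteq> S - T" "T \<noteq> S" "S - T \<noteq> S"
  using assms unfolding connected_splits_def connected_in_def by blast+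

lemma connected_splits_complement:
  "T \<in> connected_splits E S \<Longrightarrow> S - T \<in> connected_splits E S"
  unfolding connected_splits_def by (auto simp: double_diff)

lemma split_notin:
  assumes "partition_on UNIV \<pi>" "S \<in> \<pi>" "T \<in> connected_splits E S"
  shows "T \<notin> \<pi>" "S - T \<notin> \<pi>" "S \<notin> split_part \<pi> S T"
proof -
  note T = connected_splitsD[OF assms(3)]
  show "T \<notin> \<pi>" using block_unique[OF assms(1,2), of T] T by blast
  show "S - T \<notin> \<pi>" using block_unique[OF assms(1,2), of "S - T"] T by blast
  show "S \<notin> split_part \<pi> S T" using T by (auto simp: split_part_def)
qed

lemma split_part_in_bond_lattice:
  assumes \<pi>: "\<pi> \<in> bond_lattice E" and S: "S \<in> \<pi>" and T: "T \<in> connected_splits E S"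
  shows "split_part \<pi> S T \<in> bond_lattice E"
proof -
  note T' = connected_splitsD[OF T]
  have P: "partition_on UNIV \<pi>" and con: "\<And>X. X \<in> \<pi> \<Longrightarrow> connected_in E X"
    using \<pi> by (auto simp: bond_lattice_def)
  have disj: "X \<inter> S = {}" if "X \<in> \<pi> - {S}" for X
    using that block_unique[OF P S, of X] by blast
  have "partition_on UNIV (split_part \<pi> S T)"
  proof (rule partition_onI)
    have "\<Union> (split_part \<pi> S T) = \<Union> (insert S (\<pi> - {S}))"
      using T' by (auto simp: split_part_def)
    then show "\<Union> (split_part \<pi> S T) = UNIV"
      using S partition_onD1[OF P] by (simp add: insert_absorb)
    show "disjnt X Y" if "X \<in> split_part \<pi> S T" "Y \<in> split_part \<pi> S T" "X \<noteq> Y" for X Y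
    proof -
      have A: "disjnt X Y" if "X \<in> \<pi> - {S}" "Y \<in> \<pi> - {S}" "X \<noteq> Y" for X Y
        using that partition_onD2[OF P] by (auto simp: pairwise_def)
      have B: "disjnt X Y" "disjnt Y X" if "X \<in> \<pi> - {S}" "Y \<subseteq> S" for X Y
        using disj[OF that(1)] that(2) by (auto simp: disjnt_def)
      have "X = T \<or> X = S - T \<or> X \<in> \<pi> - {S}" "Y = T \<or> Y = S - T \<or> Y \<in> \<pi> - {S}"
        using that(1,2) by (auto simp: split_part_def)
      moreover have "disjnt T (S - T)" "disjnt (S - T) T" by (auto simp: disjnt_def)
      ultimately show ?thesis
        using that(3) A[of X Y] B[of X Y] B[of Y X] T'(1) by (elim disjE) auto
    qed
    show "{} \<notin> split_part \<pi> S T"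
      using T' partition_onD3[OF P] by (auto simp: split_part_def)
  qed
  moreover have "connected_in E X" if "X \<in> split_part \<pi> S T" for X
    using that T con by (auto simp: split_part_def connected_splits_def)
  ultimately show ?thesis by (simp add: bond_lattice_def)
qed

text \<open>A partition in between keeps all blocks other than \<open>S\<close>. Inside
  \<open>S\<close>, either one block contains both halves, which gives \<pi>, or the halves are
  blocks themselves.\<close>

lemma bond_covers_split_part:
  assumes \<pi>: "\<pi> \<in> bond_lattice E" and S: "S \<in> \<pi>" and T: "T \<in> connected_splits E S"
  shows "bond_covers E \<pi> (split_part \<pi> S T)"
proof -
  let ?\<pi>' = "split_part \<pi> S T"
  note T' = connected_splitsD[OF T]
  have \<pi>': "?\<pi>' \<in> bond_lattice E" by (rule split_part_in_bond_lattice[OF assms])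
  have P: "partition_on UNIV \<pi>" "partition_on UNIV ?\<pi>'"
    using \<pi> \<pi>' by (auto simp: bond_lattice_def)
  have ref: "refines UNIV ?\<pi>' \<pi>"
    unfolding refines_def using P S T' by (auto simp: split_part_def)
  have ne: "?\<pi>' \<noteq> \<pi>" using split_notin(3)[OF P(1) S T] S by blast
  have "\<rho> = ?\<pi>' \<or> \<rho> = \<pi>" if \<rho>: "refines UNIV ?\<pi>' \<rho>" "refines UNIV \<rho> \<pi>" for \<rho>
  proof -
    have R: "partition_on UNIV \<rho>" using \<rho> by (simp add: refines_def)
    have others: "\<pi> - {S} \<subseteq> \<rho>"
    proof
      fix X assume X: "X \<in> \<pi> - {S}"
      then have "X \<in> ?\<pi>'" by (simp add: split_part_def)
      then obtain Y where Y: "Y \<in> \<rho>" "X \<subseteq> Y" using \<rho>(1) unfolding refines_def by blast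
      then obtain Z where Z: "Z \<in> \<pi>" "Y \<subseteq> Z" using \<rho>(2) unfolding refines_def by blast
      have "X \<noteq> {}" using X partition_onD3[OF P(1)] by blast
      then have "X = Z" using block_unique[OF P(1), of X Z] X Y Z by blast
      then have "X = Y" using Y Z by blast
      then show "X \<in> \<rho>" using Y by simp
    qed
    have part: "\<exists>Y\<in>\<rho>. X \<subseteq> Y \<and> Y \<subseteq> S" if X: "X \<in> ?\<pi>'" "X \<subseteq> S" "X \<noteq> {}" for X
    proof -
      obtain Y where Y: "Y \<in> \<rho>" "X \<subseteq> Y" using \<rho>(1) X unfolding refines_def by blast
      then obtain Z where Z: "Z \<in> \<pi>" "Y \<subseteq> Z" using \<rho>(2) unfolding refines_def by blast
      have "Z = S" using block_unique[OF P(1) Z(1) S] X Y Z by blast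
      then show ?thesis using Y Z by blast
    qed
    obtain Y where Y: "Y \<in> \<rho>" "T \<subseteq> Y" "Y \<subseteq> S"
      using part[of T] T' by (auto simp: split_part_def)
    obtain Y' where Y': "Y' \<in> \<rho>" "S - T \<subseteq> Y'" "Y' \<subseteq> S"
      using part[of "S - T"] T' by (auto simp: split_part_def)
    show ?thesis
    proof (cases "Y = Y'")
      case True
      then have "Y = S" using Y Y' by blast
      then have "\<pi> \<subseteq> \<rho>" using others Y(1) by blast
      then show ?thesis using partition_subset_eq[OF P(1) R] by simp
    next
      case False
      then have "Y \<inter> Y' = {}" using block_unique[OF R Y(1) Y'(1)] by blast
      then have "Y = T" "Y' = S - T" using Y Y' by blast+
      then have "?\<pi>' \<subseteq> \<rho>" using others Y(1) Y'(1) by (auto simp: split_part_def)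
      then show ?thesis using partition_subset_eq[OF P(2) R] by simp
    qed
  qed
  then show ?thesis unfolding bond_covers_def using \<pi> \<pi>' ref ne by blast
qed

text \<open>Merging two parts of \<open>\<pi>'\<close> that are joined by an edge inside a part of \<open>\<pi>\<close> gives an element
  between \<open>\<pi>'\<close> and \<open>\<pi>\<close>, which must be \<open>\<pi>\<close>.\<close>

lemma split_part_of_bond_covers:
  assumes "bond_covers E \<pi> \<pi>'"
  shows "\<exists>S\<in>\<pi>. \<exists>T\<in>connected_splits E S. \<pi>' = split_part \<pi> S T"
proof -
  have \<pi>: "\<pi> \<in> bond_lattice E" and \<pi>': "\<pi>' \<in> bond_lattice E" and ref: "refines UNIV \<pi>' \<pi>"
    and ne: "\<pi>' \<noteq> \<pi>"
    and cover: "\<And>\<rho>. \<rho> \<in> bond_lattice E \<Longrightarrow> refines UNIV \<pi>' \<rho> \<Longrightarrow> refines UNIV \<rho> \<pi> \<Longrightarrow> \<rho> = \<pi>' \<or> \<rho> = \<pi>"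
    using assms unfolding bond_covers_def by blast+
  have P: "partition_on UNIV \<pi>" "partition_on UNIV \<pi>'"
    and con: "\<And>X. X \<in> \<pi> \<Longrightarrow> connected_in E X" "\<And>X. X \<in> \<pi>' \<Longrightarrow> connected_in E X"
    using \<pi> \<pi>' by (auto simp: bond_lattice_def)
  have ne_block: "X \<noteq> {}" if "X \<in> \<pi>'" for X using that partition_onD3[OF P(2)] by blast
  have "\<not> \<pi> \<subseteq> \<pi>'" using partition_subset_eq[OF P] ne by blast
  then obtain S where S: "S \<in> \<pi>" "S \<notin> \<pi>'" by blast
  have inside: "X \<subseteq> S" if X: "X \<in> \<pi>'" "x \<in> X" "x \<in> S" for X x
  proof -
    obtain Z where Z: "Z \<in> \<pi>" "X \<subseteq> Z" using ref X(1) unfolding refines_def by blast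
    then show ?thesis using block_unique[OF P(1) Z(1) S(1), of x] X by blast
  qed
  obtain x where x: "x \<in> S" using con(1)[OF S(1)] unfolding connected_in_def by blast
  obtain T where T: "T \<in> \<pi>'" "x \<in> T" using block_exists[OF P(2)] by blast
  \<comment> \<open>\<open>T\<close> is a block of \<open>\<pi>'\<close> while \<open>S\<close> is
    not, so connectedness of \<open>S\<close> provides an edge leaving \<open>T\<close>.\<close>
  have "T \<subset> S" using inside[OF T x] S T by blast
  then obtain u v where uv: "u \<in> T" "v \<in> S" "v \<notin> T" "{u, v} \<in> E"
    using crossing_edge[OF con(1)[OF S(1)], of T] T by blast
  obtain T' where T': "T' \<in> \<pi>'" "v \<in> T'" using block_exists[OF P(2)] by blast
  have T'S: "T' \<subseteq> S" using inside[OF T' uv(2)] .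
  have disj: "T \<inter> T' = {}" using block_unique[OF P(2) T(1) T'(1)] uv T' by blast
  let ?\<rho> = "insert (T \<union> T') (\<pi>' - {T, T'})"
  have R: "partition_on UNIV ?\<rho>"
  proof (rule partition_onI)
    have "\<Union> ?\<rho> = \<Union> \<pi>'" using T T' by blast
    then show "\<Union> ?\<rho> = UNIV" using partition_onD1[OF P(2)] by simp
    show "disjnt X Y" if "X \<in> ?\<rho>" "Y \<in> ?\<rho>" "X \<noteq> Y" for X Y
    proof -
      have A: "disjnt X Y" if "X \<in> \<pi>'" "Y \<in> \<pi>'" "X \<noteq> Y" for X Y
        using that partition_onD2[OF P(2)] by (auto simp: pairwise_def)
      have B: "disjnt X (T \<union> T')" if "X \<in> \<pi>' - {T, T'}" for X
        using that A[of X T] A[of X T'] T T' by (auto simp: disjnt_def)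
      have cases: "X = T \<union> T' \<or> X \<in> \<pi>' - {T, T'}" "Y = T \<union> T' \<or> Y \<in> \<pi>' - {T, T'}"
        using that(1,2) by blast+
      show ?thesis
        using cases(1)
      proof
        assume X: "X = T \<union> T'"
        then show ?thesis using cases(2) that(3) B[of Y] disjnt_sym by blast
      next
        assume X: "X \<in> \<pi>' - {T, T'}"
        show ?thesis
          using cases(2)
        proof
          assume "Y = T \<union> T'"
          then show ?thesis using B[OF X] by simp
        next
          assume "Y \<in> \<pi>' - {T, T'}"
          then show ?thesis using A[of X Y] X that(3) by simp
        qed
      qed
    qed
    show "{} \<notin> ?\<rho>" using ne_block T by auto
  qed
  have "?\<rho> \<in> bond_lattice E"
    using R con(2) connected_in_union[OF con(2)[OF T(1)] con(2)[OF T'(1)] uv(1) T'(2) uv(4)]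
    by (auto simp: bond_lattice_def)
  moreover have "refines UNIV \<pi>' ?\<rho>"
    unfolding refines_def
  proof (intro conjI P(2) R ballI)
    fix X assume "X \<in> \<pi>'"
    then have "X \<in> ?\<rho> \<or> X = T \<or> X = T'" by blast
    then show "\<exists>Y\<in>?\<rho>. X \<subseteq> Y" by auto
  qed
  moreover have "refines UNIV ?\<rho> \<pi>"
    unfolding refines_def
  proof (intro conjI P(1) R ballI)
    fix X assume "X \<in> ?\<rho>"
    then consider "X = T \<union> T'" | "X \<in> \<pi>'" by blast
    then show "\<exists>Y\<in>\<pi>. X \<subseteq> Y"
    proof cases
      case 1
      then show ?thesis using S(1) \<open>T \<subset> S\<close> T'S by blast
    next
      case 2
      then show ?thesis using ref unfolding refines_def by blast
    qed
  qed
  moreover have "T \<union> T' \<notin> \<pi>'"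
    using block_unique[OF P(2) T(1), of "T \<union> T'" x] T uv T' by blast
  ultimately have \<rho>: "?\<rho> = \<pi>" using cover by blast
  then have "T \<union> T' \<in> \<pi>" by blast
  then have TT': "T \<union> T' = S" using block_unique[OF P(1) _ S(1)] T x by blast
  then have "S - T = T'" using disj by blast
  moreover have "\<pi> - {S} = \<pi>' - {T, T'}" using \<rho> TT' S(2) by blast
  ultimately have "\<pi>' = split_part \<pi> S T" using T T' unfolding split_part_def by blast
  moreover have "T \<in> connected_splits E S"
    using \<open>T \<subset> S\<close> \<open>S - T = T'\<close> con(2) T T' unfolding connected_splits_def by blast
  ultimately show ?thesis using S(1) by blast
qed

lemma bond_covers_iff:
  assumes "\<pi> \<in> bond_lattice E"
  shows "{\<pi>'. bond_covers E \<pi> \<pi>'} = (\<Union>S\<in>\<pi>. split_part \<pi> S ` connected_splits E S)"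
proof (intro equalityI subsetI)
  fix \<pi>' assume "\<pi>' \<in> {\<pi>'. bond_covers E \<pi> \<pi>'}"
  then show "\<pi>' \<in> (\<Union>S\<in>\<pi>. split_part \<pi> S ` connected_splits E S)"
    using split_part_of_bond_covers[of E \<pi> \<pi>'] by auto
next
  fix \<pi>' assume "\<pi>' \<in> (\<Union>S\<in>\<pi>. split_part \<pi> S ` connected_splits E S)"
  then obtain S T where "S \<in> \<pi>" "T \<in> connected_splits E S" "\<pi>' = split_part \<pi> S T" by auto
  then show "\<pi>' \<in> {\<pi>'. bond_covers E \<pi> \<pi>'}"
    using bond_covers_split_part[OF assms] by simp
qed

text \<open>The new blocks are recognised by not belonging to \<pi>, so the ordered splittings of
  \<open>S\<close> map two-to-one to the covered partitions.\<close>

lemma split_part_eq_iff: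
  assumes P: "partition_on UNIV \<pi>" and S: "S \<in> \<pi>"
    and T: "T \<in> connected_splits E S" and T': "T' \<in> connected_splits E S"
  shows "split_part \<pi> S T = split_part \<pi> S T' \<longleftrightarrow> T' = T \<or> T' = S - T"
proof
  assume eq: "split_part \<pi> S T = split_part \<pi> S T'"
  have "T' \<in> split_part \<pi> S T" unfolding eq by (simp add: split_part_def)
  then show "T' = T \<or> T' = S - T"
    using split_notin(1)[OF P S T'] by (auto simp: split_part_def)
next
  have "S - (S - T) = T" using connected_splitsD(1)[OF T] by blast
  moreover assume "T' = T \<or> T' = S - T"
  ultimately show "split_part \<pi> S T = split_part \<pi> S T'"
    by (auto simp: split_part_def)
qed

text \<open>The block \<open>S\<close> is lost exactly when \<open>S\<close> itself is
  split.\<close>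

lemma split_parts_disjoint:
  assumes "partition_on UNIV \<pi>" "S \<in> \<pi>" "S' \<in> \<pi>" "S \<noteq> S'"
  shows "split_part \<pi> S ` connected_splits E S \<inter> split_part \<pi> S' ` connected_splits E S' = {}"
proof -
  have "S \<notin> split_part \<pi> S T" if "T \<in> connected_splits E S" for T
    by (rule split_notin(3)[OF assms(1,2) that])
  moreover have "S \<in> split_part \<pi> S' T" for T using assms by (simp add: split_part_def)
  ultimately show ?thesis by fastforce
qed

lemma edges_between_commute: "edges_between E S T = edges_between E T S"
  unfolding edges_between_def by (rule arg_cong[where f = card]) (auto simp: insert_commute; metis insert_commute)

lemma edge_weight_split_part:
  assumes P: "partition_on UNIV \<pi>" and S: "S \<in> \<pi>" and T: "T \<in> connected_splits E S"
  shows "edge_weight E \<pi> (split_part \<pi> S T) =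
    1 / real (nonsingleton_parts \<pi>) * (real (edges_between E T (S - T)) / real (edges_in E S))"
  unfolding edge_weight_def
proof (rule the_equality)
  note T' = connected_splitsD[OF T] and notin = split_notin[OF P S T]
  let ?\<pi>' = "split_part \<pi> S T"
  show "\<exists>U V V'. U \<in> \<pi> \<and> V \<in> ?\<pi>' \<and> V' \<in> ?\<pi>' \<and> V \<inter> V' = {} \<and> U = V \<union> V' \<and>
      \<pi> - {U} = ?\<pi>' - {V, V'} \<and>
      1 / real (nonsingleton_parts \<pi>) * (real (edges_between E T (S - T)) / real (edges_in E S)) =
      1 / real (nonsingleton_parts \<pi>) * (real (edges_between E V V') / real (edges_in E U))"
    using S T' notin
    by (intro exI[of _ S] exI[of _ T] exI[of _ "S - T"]) (auto simp: split_part_def)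
  fix w
  assume "\<exists>U V V'. U \<in> \<pi> \<and> V \<in> ?\<pi>' \<and> V' \<in> ?\<pi>' \<and> V \<inter> V' = {} \<and> U = V \<union> V' \<and>
      \<pi> - {U} = ?\<pi>' - {V, V'} \<and>
      w = 1 / real (nonsingleton_parts \<pi>) * (real (edges_between E V V') / real (edges_in E U))"
  then obtain U V V' where U: "U \<in> \<pi>" "\<pi> - {U} = ?\<pi>' - {V, V'}"
    and w: "w = 1 / real (nonsingleton_parts \<pi>) * (real (edges_between E V V') / real (edges_in E U))"
    by blast
  \<comment> \<open>Uniqueness for the definite description: \<open>S\<close> is the only block of
    \<pi> that disappears, and the two new blocks are determined up to order.\<close>
  have US: "U = S"
  proof (rule ccontr)
    assume "U \<noteq> S"
    then have "S \<in> ?\<pi>'" using S U(2) by blast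
    then show False using notin(3) by blast
  qed
  have "T \<in> {V, V'}" "S - T \<in> {V, V'}"
    using U(2) notin(1,2) by (auto simp: split_part_def)
  then have "edges_between E V V' = edges_between E T (S - T)"
    using T'(4) edges_between_commute[of E T "S - T"] by auto
  then show "w = 1 / real (nonsingleton_parts \<pi>) * (real (edges_between E T (S - T)) / real (edges_in E S))"
    using w US by simp
qed

section \<open>Summing over paths\<close>

text \<open>Passes from ordered splittings to covered partitions.\<close>

lemma finite_image_sum_two_to_one:
  fixes h :: "'b \<Rightarrow> 'c::comm_semiring_1"
  assumes "finite A" "\<And>x. x \<in> A \<Longrightarrow> card {y \<in> A. f y = f x} = 2"
  shows "(\<Sum>x\<in>A. h (f x)) = 2 * (\<Sum>y\<in>f ` A. h y)"
proof -
  have "(\<Sum>x\<in>A. h (f x)) = (\<Sum>y\<in>f ` A. \<Sum>x\<in>{x \<in> A. f x = y}. h (f x))"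
    by (rule sum.image_gen[OF assms(1)])
  also have "\<dots> = (\<Sum>y\<in>f ` A. 2 * h y)"
  proof (rule sum.cong)
    fix y assume "y \<in> f ` A"
    then have "card {x \<in> A. f x = y} = 2" using assms(2) by auto
    moreover have "(\<Sum>x\<in>{x \<in> A. f x = y}. h (f x)) = (\<Sum>x\<in>{x \<in> A. f x = y}. h y)"
      by (rule sum.cong) auto
    ultimately show "(\<Sum>x\<in>{x \<in> A. f x = y}. h (f x)) = 2 * h y" by simp
  qed simp
  finally show ?thesis by (simp add: sum_distrib_left)
qed

lemma bond_paths_unfold:
  assumes "\<pi> \<in> bond_lattice E"
  shows "bond_paths E \<pi> \<rho> =
    (if \<pi> = \<rho> then {[\<pi>]} else {}) \<union>
    (\<Union>\<pi>'\<in>{\<pi>'. bond_covers E \<pi> \<pi>'}. (#) \<pi> ` bond_paths E \<pi>' \<rho>)"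
proof (intro equalityI subsetI)
  fix p assume p: "p \<in> bond_paths E \<pi> \<rho>"
  then obtain q where q: "p = \<pi> # q" by (cases p) (auto simp: bond_paths_def)
  show "p \<in> (if \<pi> = \<rho> then {[\<pi>]} else {}) \<union>
      (\<Union>\<pi>'\<in>{\<pi>'. bond_covers E \<pi> \<pi>'}. (#) \<pi> ` bond_paths E \<pi>' \<rho>)"
  proof (cases q)
    case Nil
    then show ?thesis using p q by (simp add: bond_paths_def)
  next
    case (Cons \<pi>' r)
    then have "bond_covers E \<pi> \<pi>'" "q \<in> bond_paths E \<pi>' \<rho>"
      using p q by (auto simp: bond_paths_def)
    then show ?thesis using q by blast
  qed
next
  fix p assume "p \<in> (if \<pi> = \<rho> then {[\<pi>]} else {}) \<union>
      (\<Union>\<pi>'\<in>{\<pi>'. bond_covers E \<pi> \<pi>'}. (#) \<pi> ` bond_paths E \<pi>' \<rho>)"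
  then consider "\<pi> = \<rho>" "p = [\<pi>]"
    | \<pi>' q where "bond_covers E \<pi> \<pi>'" "q \<in> bond_paths E \<pi>' \<rho>" "p = \<pi> # q"
    by (auto split: if_splits)
  then show "p \<in> bond_paths E \<pi> \<rho>"
  proof cases
    case 1
    then show ?thesis using assms by (simp add: bond_paths_def)
  next
    case 2
    then show ?thesis using assms by (auto simp: bond_paths_def successively_Cons)
  qed
qed

lemma path_weight_Cons:
  assumes "q \<in> bond_paths E \<pi>' \<rho>"
  shows "path_weight E (\<pi> # q) = edge_weight E \<pi> \<pi>' * path_weight E q"
proof -
  obtain r where r: "q = \<pi>' # r" using assms by (cases q) (auto simp: bond_paths_def)
  show ?thesis unfolding path_weight_def r by (simp add: prod.lessThan_Suc_shift del: prod.lessThan_Suc)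
qed

text \<open>The number of blocks grows along covers, which supplies the induction measure for
  paths.\<close>

lemma bond_covers_card:
  fixes \<pi> :: "'v::finite set set"
  assumes "bond_covers E \<pi> \<pi>'"
  shows "card \<pi>' = Suc (card \<pi>)"
proof -
  have P: "partition_on UNIV \<pi>" using assms by (simp add: bond_covers_def bond_lattice_def)
  obtain S T where S: "S \<in> \<pi>" and T: "T \<in> connected_splits E S" and \<pi>': "\<pi>' = split_part \<pi> S T"
    using split_part_of_bond_covers[OF assms] by blast
  have "card \<pi>' = Suc (Suc (card (\<pi> - {S})))"
    unfolding \<pi>' split_part_def using split_notin(1,2)[OF P S T] connected_splitsD(4)[OF T]
    by simp
  moreover have "card \<pi> > 0" using S by (auto simp: card_gt_0_iff)
  ultimately show ?thesis using S by simp
qed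

lemma bond_lattice_singletons:
  fixes \<pi> :: "'v::finite set set"
  assumes \<pi>: "\<pi> \<in> bond_lattice E" and small: "\<And>S. S \<in> \<pi> \<Longrightarrow> \<not> card S > 1"
  shows "\<pi> = singletons"
proof (rule partition_subset_eq)
  show "partition_on UNIV \<pi>" using \<pi> by (simp add: bond_lattice_def)
  show "partition_on UNIV singletons"
    unfolding singletons_def by (rule partition_on_singletons)
  show "\<pi> \<subseteq> singletons"
  proof
    fix S assume S: "S \<in> \<pi>"
    then have "S \<noteq> {}" using \<pi> by (auto simp: bond_lattice_def connected_in_def)
    then have "card S > 0" by (simp add: card_gt_0_iff)
    then have "card S = 1" using small[OF S] by linarith
    then show "S \<in> singletons" unfolding singletons_def by (auto simp: card_1_singleton_iff)
  qed
qed

lemma connected_splits_singleton: "card S \<le> 1 \<Longrightarrow> connected_splits E (S :: 'v::finite set) = {}"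
proof (rule equals0I)
  fix T assume "card S \<le> 1" and T: "T \<in> connected_splits E S"
  then obtain x y where "x \<in> S" "y \<in> S" "x \<noteq> y" using connected_splitsD(1-3)[OF T] by blast
  then show False using \<open>card S \<le> 1\<close> card_le_Suc0_iff_eq[of S] by auto
qed

section \<open>The path sum for an abstract solution \<open>m\<close> of the edge recursion\<close>

context
  fixes E :: "'v::finite set set" and m :: "'v set \<Rightarrow> real"
  assumes recursion: "\<And>S. 2 * edges_in E S * m S =
      (\<Sum>T\<in>Pow S. edges_between E T (S - T) * (m T * m (S - T)))"
    and disconnected: "\<And>S. S \<noteq> {} \<Longrightarrow> \<not> connected_in E S \<Longrightarrow> m S = 0"
    and singleton: "\<And>a. m {a} = 1"
begin

text \<open>A non-empty disconnected part has \<open>m\<close> equal to 0. The value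
  \<open>m {}\<close> is unconstrained, but a splitting with an empty part has no edges between its
  parts.\<close>

lemma sum_connected_splits:
  "(\<Sum>T\<in>connected_splits E S. edges_between E T (S - T) * (m T * m (S - T))) =
    2 * edges_in E S * m S"
  unfolding recursion
proof (rule sum.mono_neutral_left)
  show "connected_splits E S \<subseteq> Pow S" by (auto simp: connected_splits_def)
  show "\<forall>T\<in>Pow S - connected_splits E S. edges_between E T (S - T) * (m T * m (S - T)) = 0"
  proof
    fix T assume T: "T \<in> Pow S - connected_splits E S"
    show "edges_between E T (S - T) * (m T * m (S - T)) = 0"
    proof (cases "T = {} \<or> S - T = {}")
      case True
      then have "edges_between E T (S - T) = 0" by (auto simp: edges_between_def)
      then show ?thesis by simp
    next
      case False
      then have "m T = 0 \<or> m (S - T) = 0"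
        using T disconnected[of T] disconnected[of "S - T"] by (auto simp: connected_splits_def)
      then show ?thesis by auto
    qed
  qed
qed simp

text \<open>By the recursion the edge weights cancel against \<open>edges_in E S\<close>, so
  splitting one non-singleton block yields the share \<open>1 / nonsingleton_parts \<pi>\<close> of
  the product. The factor 2 accounts for ordered splittings.\<close>

lemma sum_split_parts:
  assumes \<pi>: "\<pi> \<in> bond_lattice E" and S: "S \<in> \<pi>"
  shows "(\<Sum>\<pi>'\<in>split_part \<pi> S ` connected_splits E S. edge_weight E \<pi> \<pi>' * prod m \<pi>') =
    (if card S > 1 then prod m \<pi> / nonsingleton_parts \<pi> else 0)"
proof (cases "card S > 1")
  case True
  have P: "partition_on UNIV \<pi>" and con: "connected_in E S"
    using \<pi> S by (auto simp: bond_lattice_def)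
  let ?C = "connected_splits E S" and ?d = "real (nonsingleton_parts \<pi>)" and ?e = "real (edges_in E S)"
  have e: "?e > 0" using edges_in_pos[OF con True] by simp
  have two: "card {U \<in> ?C. split_part \<pi> S U = split_part \<pi> S T} = 2" if T: "T \<in> ?C" for T
  proof -
    have "{U \<in> ?C. split_part \<pi> S U = split_part \<pi> S T} = {T, S - T}"
      using split_part_eq_iff[OF P S T] T connected_splits_complement[OF T] by blast
    then show ?thesis using connected_splitsD(4)[OF T] by simp
  qed
  have "2 * (\<Sum>\<pi>'\<in>split_part \<pi> S ` ?C. edge_weight E \<pi> \<pi>' * prod m \<pi>') =
      (\<Sum>T\<in>?C. edge_weight E \<pi> (split_part \<pi> S T) * prod m (split_part \<pi> S T))"
    by (rule finite_image_sum_two_to_one[symmetric]) (simp, rule two)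
  also have "\<dots> = (\<Sum>T\<in>?C. (edges_between E T (S - T) * (m T * m (S - T))) *
      (prod m (\<pi> - {S}) / (?d * ?e)))"
  proof (rule sum.cong)
    fix T assume T: "T \<in> ?C"
    have "prod m (split_part \<pi> S T) = m T * (m (S - T) * prod m (\<pi> - {S}))"
      unfolding split_part_def using split_notin(1,2)[OF P S T] connected_splitsD(4)[OF T] by simp
    then show "edge_weight E \<pi> (split_part \<pi> S T) * prod m (split_part \<pi> S T) =
        (edges_between E T (S - T) * (m T * m (S - T))) * (prod m (\<pi> - {S}) / (?d * ?e))"
      unfolding edge_weight_split_part[OF P S T] by simp
  qed simp
  also have "\<dots> = 2 * ?e * m S * (prod m (\<pi> - {S}) / (?d * ?e))"
    unfolding sum_distrib_right[symmetric] sum_connected_splits by simp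
  also have "\<dots> = 2 * (m S * prod m (\<pi> - {S}) / ?d)"
    using e by simp
  also have "m S * prod m (\<pi> - {S}) = prod m \<pi>"
    using S by (simp add: prod.remove)
  finally show ?thesis using True by simp
qed (simp add: connected_splits_singleton)

text \<open>The equal shares of the non-singleton blocks add up to the whole product; there is at
  least one such block because \<pi> differs from \<open>singletons\<close>.\<close>

lemma sum_covers:
  assumes \<pi>: "\<pi> \<in> bond_lattice E" and ne: "\<pi> \<noteq> singletons"
  shows "(\<Sum>\<pi>'\<in>{\<pi>'. bond_covers E \<pi> \<pi>'}. edge_weight E \<pi> \<pi>' * prod m \<pi>') = prod m \<pi>"
proof -
  have P: "partition_on UNIV \<pi>" using \<pi> by (simp add: bond_lattice_def)
  have d: "nonsingleton_parts \<pi> \<noteq> 0"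
    using bond_lattice_singletons[OF \<pi>] ne by (auto simp: nonsingleton_parts_def)
  have "(\<Sum>\<pi>'\<in>{\<pi>'. bond_covers E \<pi> \<pi>'}. edge_weight E \<pi> \<pi>' * prod m \<pi>') =
      (\<Sum>S\<in>\<pi>. \<Sum>\<pi>'\<in>split_part \<pi> S ` connected_splits E S. edge_weight E \<pi> \<pi>' * prod m \<pi>')"
    unfolding bond_covers_iff[OF \<pi>]
    using split_parts_disjoint[OF P] by (intro sum.UNION_disjoint) auto
  also have "\<dots> = (\<Sum>S\<in>\<pi>. if card S > 1 then prod m \<pi> / nonsingleton_parts \<pi> else 0)"
    by (rule sum.cong[OF HOL.refl sum_split_parts[OF \<pi>]])
  also have "\<dots> = (\<Sum>S\<in>{S \<in> \<pi>. card S > 1}. prod m \<pi> / nonsingleton_parts \<pi>)"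
    by (rule sum.inter_filter[symmetric]) simp
  also have "\<dots> = prod m \<pi>" using d by (simp add: nonsingleton_parts_def)
  finally show ?thesis .
qed

lemma singletons_minimal: "\<not> bond_covers E singletons \<pi>"
proof
  assume "bond_covers E singletons \<pi>"
  then obtain S T where "S \<in> singletons" "T \<in> connected_splits E S"
    using split_part_of_bond_covers by blast
  then show False using connected_splits_singleton[of S E] by (auto simp: singletons_def)
qed

text \<open>Finiteness is carried through the induction because a sum over an infinite set of paths
  would be 0 by convention.\<close>

theorem sum_path_weights:
  assumes "\<pi> \<in> bond_lattice E"
  shows "finite (bond_paths E \<pi> singletons) \<and>
    (\<Sum>p\<in>bond_paths E \<pi> singletons. path_weight E p) = prod m \<pi>"
  using assms
proof (induction "card (UNIV :: 'v set set) - card \<pi>" arbitrary: \<pi> rule: less_induct)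
  case less
  show ?case
  proof (cases "\<pi> = singletons")
    case True
    have "bond_paths E \<pi> singletons = {[\<pi>]}"
      unfolding bond_paths_unfold[OF less.prems] using True singletons_minimal by auto
    moreover have "prod m \<pi> = 1"
      unfolding True singletons_def by (rule prod.neutral) (auto simp: singleton)
    ultimately show ?thesis by (simp add: path_weight_def)
  next
    case False
    let ?C = "{\<pi>'. bond_covers E \<pi> \<pi>'}"
    have IH: "finite (bond_paths E \<pi>' singletons)"
      "(\<Sum>p\<in>bond_paths E \<pi>' singletons. path_weight E p) = prod m \<pi>'" if "\<pi>' \<in> ?C" for \<pi>'
    proof -
      have "card \<pi>' = Suc (card \<pi>)" using bond_covers_card that by blast
      moreover have "card \<pi>' \<le> card (UNIV :: 'v set set)" by (rule card_mono) auto
      ultimately have "card (UNIV :: 'v set set) - card \<pi>' < card (UNIV :: 'v set set) - card \<pi>"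
        by linarith
      moreover have "\<pi>' \<in> bond_lattice E" using that by (simp add: bond_covers_def)
      ultimately show "finite (bond_paths E \<pi>' singletons)"
        "(\<Sum>p\<in>bond_paths E \<pi>' singletons. path_weight E p) = prod m \<pi>'"
        using less.hyps by blast+
    qed
    have paths: "bond_paths E \<pi> singletons = (\<Union>\<pi>'\<in>?C. (#) \<pi> ` bond_paths E \<pi>' singletons)"
      unfolding bond_paths_unfold[OF less.prems] using False by simp
    have disj: "(#) \<pi> ` bond_paths E \<rho> singletons \<inter> (#) \<pi> ` bond_paths E \<rho>' singletons = {}"
      if "\<rho> \<noteq> \<rho>'" for \<rho> \<rho>'
    proof -
      have "hd q = \<rho>" if "q \<in> bond_paths E \<rho> singletons" for q \<rho>
        using that by (simp add: bond_paths_def)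
      then show ?thesis using that by blast
    qed
    have "(\<Sum>p\<in>bond_paths E \<pi> singletons. path_weight E p) =
        (\<Sum>\<pi>'\<in>?C. \<Sum>p\<in>(#) \<pi> ` bond_paths E \<pi>' singletons. path_weight E p)"
      unfolding paths using IH(1) disj by (intro sum.UNION_disjoint) simp_all
    also have "\<dots> = (\<Sum>\<pi>'\<in>?C. edge_weight E \<pi> \<pi>' * prod m \<pi>')"
    proof (rule sum.cong)
      fix \<pi>' assume \<pi>': "\<pi>' \<in> ?C"
      have "(\<Sum>p\<in>(#) \<pi> ` bond_paths E \<pi>' singletons. path_weight E p) =
          (\<Sum>q\<in>bond_paths E \<pi>' singletons. edge_weight E \<pi> \<pi>' * path_weight E q)"
        by (subst sum.reindex) (auto simp: path_weight_Cons)
      then show "(\<Sum>p\<in>(#) \<pi> ` bond_paths E \<pi>' singletons. path_weight E p) =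
          edge_weight E \<pi> \<pi>' * prod m \<pi>'"
        using IH(2)[OF \<pi>'] by (simp add: sum_distrib_left[symmetric])
    qed simp
    also have "\<dots> = prod m \<pi>" by (rule sum_covers[OF less.prems False])
    finally show ?thesis unfolding paths using IH(1) by simp
  qed
qed

end

theorem proposition1p5:
  fixes E :: "'v::finite set set"
    and hscale :: "complex \<Rightarrow> 'h::ab_group_add \<Rightarrow> 'h"
    and \<alpha> :: "'v \<Rightarrow> 'h \<Rightarrow> complex"
    and coroot :: "'v \<Rightarrow> 'h"
    and \<pi> :: "'v set set"
  assumes "simple_graph E"
    and "minimal_realization hscale (cartan_matrix E) \<alpha> coroot"
    and "\<pi> \<in> bond_lattice E"
  shows "real (partition_mult hscale E \<alpha> coroot \<pi>) =
    (\<Sum>p\<in>bond_paths E \<pi> singletons. path_weight E p)"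
proof -
  interpret graph_kac_moody E hscale \<alpha> coroot
    using assms(1,2) by (rule graph_kac_moody.intro)
  define m where "m S = root_mult hscale (cartan_matrix E) \<alpha> coroot (root_sum \<alpha> S)" for S
  have m: "m S = card (rooted_orientations E a S)" if "a \<in> S" for S a
    unfolding m_def by (rule root_mult_eq_card[OF that])
  \<comment> \<open>\<open>edges_in_recursion\<close> asks for a count that agrees with every choice
    of sink, and the root multiplicity is one.\<close>
  have rec: "2 * edges_in E S * real (m S) =
      (\<Sum>T\<in>Pow S. edges_between E T (S - T) * (real (m T) * real (m (S - T))))" for S
    using arg_cong[OF edges_in_recursion[OF assms(1) m, of S], of real] by simp
  have "(\<Sum>p\<in>bond_paths E \<pi> singletons. path_weight E p) = (\<Prod>S\<in>\<pi>. real (m S))"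
  proof (rule conjunct2[OF sum_path_weights[OF rec _ _ assms(3)]])
    show "real (m S) = 0" if S: "S \<noteq> {}" "\<not> connected_in E S" for S
    proof -
      obtain a where a: "a \<in> S" using S(1) by blast
      then have "rooted_orientations E a S = {}"
        using connected_in_of_rooted_orientation[of _ E a S] S(2) by (intro equals0I) blast
      then show ?thesis using m[OF a] by simp
    qed
    show "real (m {a}) = 1" for a
      using m[of a "{a}"] card_rooted_orientations_singleton[OF no_loop] by simp
  qed
  then show ?thesis by (simp add: partition_mult_def m_def)
qed

end
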